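(* Let $\Gamma$ be a simple graph on $V=\{1,\dots,n\}$ with edge ideal $I\subseteq k[x_1,\dots,x_n]$ and let $F$ be a cover of $\Gamma$. Then $P_F$ belongs to $\operatorname{Ass}^\infty(I)$ if and only if $F$ is a minimal cover or $F$ is minimal among the covers of $\Gamma$ containing $N[U]$ for a subset $U$ of $V$ such that every connected component of the induced graph $\Gamma_U$ contains at least one odd cycle.
   Context: $k$ is a field, $n\ge 1$. The edge ideal of $\Gamma$ is the ideal generated by the $x_ix_j$ with $\{i,j\}$ an edge of $\Gamma$. A cover of $\Gamma$ is a set of vertices meeting every edge; a minimal cover is one minimal under inclusion. For $F\subseteq V$, $P_F$ is the ideal generated by the variables $x_i$, $i\in F$. $\operatorname{Ass}(I^t)$ is the set of associated primes of $I^t$; there is $t_0$ such that $\operatorname{Ass}(I^t)=\operatorname{Ass}(I^{t+1})$ for all $t\ge t_0$ (Brodmann), and $\operatorname{Ass}^\infty(I)$ denotes the stable set $\operatorname{Ass}(I^{t_0})$. For $U\subseteq V$, $\Gamma_U$ is the induced subgraph of $\Gamma$ on $U$, and $N[U]$ is the union of $U$ and the set of vertices adjacent to some vertex of $U$ (closed neighborhood). "$F$ is minimal among the covers containing $N$" means that $F$ is a cover containing $N$ and no proper subset of $F$ is a cover containing $N$. *)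

theory Defs
  imports
    "HOL-Library.Poly_Mapping"
    "HOL-Algebra.Ideal_Product"
    "HOL-Algebra.Subrings"
    "HOL-Algebra.Algebraic_Closure_Type"
    "Graph_Theory.Graph_Theory"
begin

section \<open>Polynomial rings and associated primes\<close>

text \<open>A monomial is a finitely supported exponent vector, and a polynomial is a finitely supported
  family of coefficients indexed by monomials. The library multiplication on
  finitely supported maps is then the usual (convolution) product of polynomials.\<close>

type_synonym ('v, 'k) mpolynomial = "('v \<Rightarrow>\<^sub>0 nat) \<Rightarrow>\<^sub>0 'k"

definition mpoly_ring :: "'v set \<Rightarrow> ('v, 'k::field) mpolynomial ring" where
  "mpoly_ring V = ring_of_type_algebra
     \<lparr>carrier := {p. \<forall>m \<in> Poly_Mapping.keys p. Poly_Mapping.keys m \<subseteq> V}\<rparr>"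

definition mvar :: "'v \<Rightarrow> ('v, 'k::field) mpolynomial" where
  "mvar i = Poly_Mapping.single (Poly_Mapping.single i 1) 1"

text \<open>The set in the definition below is the annihilator of the class of \<open>f\<close> in the module
  \<open>R/I\<close>: these are the associated primes of \<open>R/I\<close>, called associated primes of \<open>I\<close>.\<close>

definition associated_primes :: "('a, 'b) ring_scheme \<Rightarrow> 'a set \<Rightarrow> 'a set set" where
  "associated_primes R I =
     {P. primeideal P R \<and> (\<exists>f \<in> carrier R. P = {g \<in> carrier R. g \<otimes>\<^bsub>R\<^esub> f \<in> I})}"

definition ideal_power :: "('a, 'b) ring_scheme \<Rightarrow> 'a set \<Rightarrow> nat \<Rightarrow> 'a set" where
  "ideal_power R I t = I [^]\<^bsub>ideals_set R\<^esub> t"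

text \<open>The value at the least index from which on the sequence of sets is constant. Such an index
  exists for an ideal of a Noetherian ring by Brodmann's theorem; which one is taken is
  immaterial.\<close>

definition stable_associated_primes :: "('a, 'b) ring_scheme \<Rightarrow> 'a set \<Rightarrow> 'a set set" where
  "stable_associated_primes R I =
     associated_primes R (ideal_power R I
       (LEAST t0. \<forall>t\<ge>t0. associated_primes R (ideal_power R I t) =
                         associated_primes R (ideal_power R I (Suc t))))"

section \<open>Graphs\<close>

text \<open>A finite simple graph is a \<^locale>\<open>pair_graph\<close>: a finite loop-free digraph whose set of arcs is
  symmetric. The edge \<open>{i,j}\<close> is given by the two arcs \<open>(i,j)\<close> and \<open>(j,i)\<close>.\<close>

definition edge_ideal :: "'v pair_pre_digraph \<Rightarrow> ('v, 'k::field) mpolynomial set" where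
  "edge_ideal G = Idl\<^bsub>mpoly_ring (pverts G)\<^esub> {mvar i * mvar j | i j. (i, j) \<in> parcs G}"

definition variable_ideal :: "'v set \<Rightarrow> 'v set \<Rightarrow> ('v, 'k::field) mpolynomial set" where
  "variable_ideal V F = Idl\<^bsub>mpoly_ring V\<^esub> (mvar ` F)"

definition cover :: "'v pair_pre_digraph \<Rightarrow> 'v set \<Rightarrow> bool" where
  "cover G F \<longleftrightarrow> F \<subseteq> pverts G \<and> (\<forall>(i, j) \<in> parcs G. i \<in> F \<or> j \<in> F)"

definition minimal_cover :: "'v pair_pre_digraph \<Rightarrow> 'v set \<Rightarrow> bool" where
  "minimal_cover G F \<longleftrightarrow> cover G F \<and> \<not> (\<exists>F'. F' \<subset> F \<and> cover G F')"

definition minimal_cover_containing ::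
    "'v pair_pre_digraph \<Rightarrow> 'v set \<Rightarrow> 'v set \<Rightarrow> bool" where
  "minimal_cover_containing G N F \<longleftrightarrow>
     cover G F \<and> N \<subseteq> F \<and> \<not> (\<exists>F'. F' \<subset> F \<and> cover G F' \<and> N \<subseteq> F')"

definition closed_neighborhood :: "'v pair_pre_digraph \<Rightarrow> 'v set \<Rightarrow> 'v set" where
  "closed_neighborhood G U = U \<union> {j. \<exists>i \<in> U. (i, j) \<in> parcs G}"

definition connected_component :: "('v, 'e) pre_digraph \<Rightarrow> ('v, 'e) pre_digraph \<Rightarrow> bool" where
  "connected_component G H \<longleftrightarrow> pre_digraph.max_subgraph G Digraph_Component.connected H"

text \<open>The notion of cycle for digraphs also admits the closed walk \<open>i, j, i\<close> along a single edge.
  It has length 2, so in a simple graph the cycles of odd length are the usual ones.\<close>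

definition has_odd_cycle :: "('v, 'e) pre_digraph \<Rightarrow> bool" where
  "has_odd_cycle G \<longleftrightarrow> (\<exists>p. pre_digraph.cycle G p \<and> odd (length p))"

end

theory Submission
  imports Defs
begin

text \<open>Since \<open>I\<^sup>t\<close> is a monomial ideal, its associated primes are the \<open>P\<^sub>F\<close> for which some
  monomial \<open>x\<^sup>a\<close> satisfies \<open>(I\<^sup>t : x\<^sup>a) = P\<^sub>F\<close>. A monomial lies in \<open>I\<^sup>t\<close> iff \<open>t\<close> edges, counted with
  multiplicity, can be packed under its exponent vector, so this is a statement on maximum packings: \<open>F\<close>
  must be the set of neighbours of the vertices \<open>D\<close> missed by some maximum packing under \<open>a\<close>.

  Given such an \<open>a\<close>, take \<open>U = D \<inter> F\<close>, the non-isolated vertices of the graph induced on \<open>D\<close>. For an edge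
  \<open>{u, w}\<close> in \<open>D\<close>, comparing a maximum packing missing \<open>u\<close> with one missing \<open>w\<close> gives, as in the
  Gallai--Edmonds theory, an alternating walk of even length from \<open>u\<close> to \<open>w\<close> inside \<open>D\<close>, hence an odd cycle
  in the component of \<open>u\<close>. Conversely, a component with an odd cycle carries an \<open>a\<close> of odd size such
  that removing any one vertex leaves a perfectly packed vector; the sum of these over the components of
  \<open>\<Gamma>\<^sub>U\<close> and of one copy of each vertex outside \<open>F\<close> is the required exponent vector. Adding copies of an edge
  inside \<open>U\<close> (or at a vertex of \<open>F\<close>, if \<open>U\<close> is empty) reaches all larger \<open>t\<close>, which also gives the stability of \<open>Ass(I\<^sup>t)\<close>.\<close>

section \<open>Associated primes of monomial ideals\<close>

lemma mpoly_ring_simps [simp]: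
  "carrier (mpoly_ring V) = {p. \<forall>m \<in> Poly_Mapping.keys p. Poly_Mapping.keys m \<subseteq> V}"
  "monoid.mult (mpoly_ring V) = (*)"
  "monoid.one (mpoly_ring V) = 1"
  "ring.zero (mpoly_ring V) = 0"
  "ring.add (mpoly_ring V) = (+)"
  by (simp_all add: mpoly_ring_def ring_of_type_algebra_def)

lemma keys_exponent_add:
  "Poly_Mapping.keys (a + b :: 'v \<Rightarrow>\<^sub>0 nat) = Poly_Mapping.keys a \<union> Poly_Mapping.keys b"
  by (auto simp: in_keys_iff lookup_add)

lemma mpoly_carrier_mult:
  assumes "p \<in> carrier (mpoly_ring V)" "q \<in> carrier (mpoly_ring V)"
  shows "p * q \<in> carrier (mpoly_ring V)"
  using assms keys_mult[of p q] by (fastforce simp: keys_exponent_add)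

lemma mpoly_carrier_add:
  assumes "p \<in> carrier (mpoly_ring V)" "q \<in> carrier (mpoly_ring V)"
  shows "p + q \<in> carrier (mpoly_ring V)"
  using assms Poly_Mapping.keys_add[of p q] by auto

lemma keys_uminus [simp]: "Poly_Mapping.keys (- p :: 'a \<Rightarrow>\<^sub>0 'b::ab_group_add) = Poly_Mapping.keys p"
  by (auto simp: in_keys_iff)

lemma cring_mpoly_ring: "cring (mpoly_ring V :: ('v, 'k::field) mpolynomial ring)"
proof (intro cringI abelian_groupI comm_monoidI)
  fix p :: "('v, 'k) mpolynomial"
  assume "p \<in> carrier (mpoly_ring V)"
  then show "\<exists>q\<in>carrier (mpoly_ring V). q \<oplus>\<^bsub>mpoly_ring V\<^esub> p = \<zero>\<^bsub>mpoly_ring V\<^esub>"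
    by (intro bexI[of _ "- p"]) auto
next
  fix p q :: "('v, 'k) mpolynomial"
  assume "p \<in> carrier (mpoly_ring V)" "q \<in> carrier (mpoly_ring V)"
  then show "p \<oplus>\<^bsub>mpoly_ring V\<^esub> q \<in> carrier (mpoly_ring V)" "p \<otimes>\<^bsub>mpoly_ring V\<^esub> q \<in> carrier (mpoly_ring V)"
    using mpoly_carrier_add[of p V q] mpoly_carrier_mult[of p V q] by simp_all
qed (simp_all add: algebra_simps)

lemma single_times_monomial:
  fixes p :: "('v, 'k::field) mpolynomial"
  shows "Poly_Mapping.keys (Poly_Mapping.single b 1 * p) = (+) b ` Poly_Mapping.keys p"
proof -
  have "Poly_Mapping.lookup (Poly_Mapping.single b 1 * p) (b + m) = Poly_Mapping.lookup p m" for m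
    by (simp add: lookup_mult lookup_single when_mult Sum_any_when_dependent_prod_right)
  then have "(+) b ` Poly_Mapping.keys p \<subseteq> Poly_Mapping.keys (Poly_Mapping.single b 1 * p)"
    by (auto simp: in_keys_iff)
  moreover have "Poly_Mapping.keys (Poly_Mapping.single b 1 * p) \<subseteq> (+) b ` Poly_Mapping.keys p"
    using keys_mult[of "Poly_Mapping.single b 1" p] by (auto split: if_splits)
  ultimately show ?thesis by blast
qed

lemma sum_of_monomials:
  fixes p :: "'a \<Rightarrow>\<^sub>0 'b::comm_monoid_add"
  shows "p = (\<Sum>m\<in>Poly_Mapping.keys p. Poly_Mapping.single m (Poly_Mapping.lookup p m))"
  by (rule poly_mapping_eqI)
    (auto simp: lookup_sum lookup_single when_def in_keys_iff if_distrib cong: if_cong)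

lemma mem_if_monomials_mem:
  fixes p :: "'a \<Rightarrow>\<^sub>0 'b::comm_monoid_add"
  assumes "0 \<in> S" and "\<And>p q. p \<in> S \<Longrightarrow> q \<in> S \<Longrightarrow> p + q \<in> S"
    and "\<And>m. m \<in> Poly_Mapping.keys p \<Longrightarrow> Poly_Mapping.single m (Poly_Mapping.lookup p m) \<in> S"
  shows "p \<in> S"
proof -
  have "sum (\<lambda>m. Poly_Mapping.single m (Poly_Mapping.lookup p m)) K \<in> S"
    if "finite K" "K \<subseteq> Poly_Mapping.keys p" for K
    using that by (induction K) (use assms in auto)
  from this[of "Poly_Mapping.keys p"] show ?thesis
    by (simp flip: sum_of_monomials)
qed

text \<open>Used to separate one distinguished term from the rest, or the terms divisible by a
  variable of \<open>F\<close> from the others.\<close>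

lemma split_keys:
  fixes p :: "'a \<Rightarrow>\<^sub>0 'b::comm_monoid_add"
  obtains q r where "p = q + r" "Poly_Mapping.keys q = Poly_Mapping.keys p - S"
    "Poly_Mapping.keys r = Poly_Mapping.keys p \<inter> S"
proof -
  let ?q = "\<lambda>S. \<Sum>m\<in>Poly_Mapping.keys p \<inter> S. Poly_Mapping.single m (Poly_Mapping.lookup p m)"
  have *: "Poly_Mapping.lookup (?q S) m = (if m \<in> S then Poly_Mapping.lookup p m else 0)" for S m
    by (auto simp: lookup_sum lookup_single when_def in_keys_iff if_distrib cong: if_cong)
  show ?thesis
    by (rule that[of "?q (- S)" "?q S"])
      (auto intro!: poly_mapping_eqI simp: lookup_add * in_keys_iff split: if_splits)
qed

lemma exponent_induct [case_names zero add]: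
  fixes m :: "'v \<Rightarrow>\<^sub>0 nat"
  assumes "P 0" "\<And>i m. P m \<Longrightarrow> P (Poly_Mapping.single i 1 + m)"
  shows "P m"
proof (induction m rule: update_induct)
  case const
  show ?case by (simp add: assms(1))
next
  case (update f a b)
  have "P (Poly_Mapping.single a c + f)" for c
  proof (induction c)
    case (Suc c)
    have "Poly_Mapping.single a (Suc c) = Poly_Mapping.single a 1 + Poly_Mapping.single a c"
      by (simp flip: single_add)
    then show ?case using assms(2)[OF Suc, of a] by (simp add: add.assoc)
  qed (use update in simp)
  moreover have "Poly_Mapping.update a b f = Poly_Mapping.single a b + f"
    using update by (intro poly_mapping_eqI) (auto simp: lookup_add lookup_update lookup_single in_keys_iff)
  ultimately show ?case by simp
qed

section \<open>Monomial ideals described by sets of exponents\<close>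

definition monomial_ideal :: "'v set \<Rightarrow> ('v \<Rightarrow>\<^sub>0 nat) set \<Rightarrow> ('v, 'k::field) mpolynomial set" where
  "monomial_ideal V A = {p \<in> carrier (mpoly_ring V). Poly_Mapping.keys p \<subseteq> A}"

text \<open>This closure property turns the additive group \<open>monomial_ideal V A\<close> into an
  ideal. \<open>A\<close> may contain exponents not supported in \<open>V\<close>, since
  \<open>monomial_ideal\<close> intersects with the ring.\<close>

definition exponent_filter :: "'v set \<Rightarrow> ('v \<Rightarrow>\<^sub>0 nat) set \<Rightarrow> bool" where
  "exponent_filter V A \<longleftrightarrow> (\<forall>m\<in>A. \<forall>b. Poly_Mapping.keys b \<subseteq> V \<longrightarrow> b + m \<in> A)"

lemma exponent_filterD:
  "exponent_filter V A \<Longrightarrow> m \<in> A \<Longrightarrow> Poly_Mapping.keys b \<subseteq> V \<Longrightarrow> b + m \<in> A"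
  by (simp add: exponent_filter_def)

lemma single_in_monomial_ideal:
  "Poly_Mapping.keys m \<subseteq> V \<Longrightarrow> m \<in> A \<Longrightarrow> Poly_Mapping.single m c \<in> monomial_ideal V A"
  by (simp add: monomial_ideal_def)

lemma monomial_ideal_add:
  "p \<in> monomial_ideal V A \<Longrightarrow> q \<in> monomial_ideal V A \<Longrightarrow> p + q \<in> monomial_ideal V A"
  unfolding monomial_ideal_def
  using Poly_Mapping.keys_add[of p q] mpoly_carrier_add[of p V q] by blast

lemma monomial_ideal_mult:
  assumes "exponent_filter V A" "p \<in> carrier (mpoly_ring V)" "q \<in> monomial_ideal V A"
  shows "p * q \<in> monomial_ideal V A"
proof -
  have "Poly_Mapping.keys (p * q) \<subseteq> A"
  proof
    fix m assume "m \<in> Poly_Mapping.keys (p * q)"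
    then obtain a b where "m = a + b" "a \<in> Poly_Mapping.keys p" "b \<in> Poly_Mapping.keys q"
      using keys_mult[of p q] by blast
    then show "m \<in> A"
      using assms exponent_filterD[of V A b a] by (auto simp: monomial_ideal_def)
  qed
  then show ?thesis
    using assms mpoly_carrier_mult[of p V q] by (simp add: monomial_ideal_def)
qed

lemma ideal_monomial_ideal:
  assumes "exponent_filter V A"
  shows "ideal (monomial_ideal V A :: ('v, 'k::field) mpolynomial set) (mpoly_ring V)"
proof -
  interpret cring "mpoly_ring V :: ('v, 'k) mpolynomial ring" by (rule cring_mpoly_ring)
  have neg: "\<ominus>\<^bsub>mpoly_ring V\<^esub> p = - p" if "p \<in> carrier (mpoly_ring V)" for p :: "('v, 'k) mpolynomial"
    by (rule minus_equality) (use that in auto)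
  show ?thesis
  proof (rule idealI)
    show "subgroup (monomial_ideal V A) (add_monoid (mpoly_ring V :: ('v, 'k) mpolynomial ring))"
    proof (rule add.subgroupI)
      show "monomial_ideal V A \<noteq> ({} :: ('v, 'k) mpolynomial set)"
        by (auto simp: monomial_ideal_def intro!: exI[of _ 0])
    next
      fix p :: "('v, 'k) mpolynomial"
      assume "p \<in> monomial_ideal V A"
      then show "\<ominus>\<^bsub>mpoly_ring V\<^esub> p \<in> monomial_ideal V A"
        using neg[of p] by (simp add: monomial_ideal_def)
    qed (auto simp: monomial_ideal_add, auto simp: monomial_ideal_def)
  next
    fix p q :: "('v, 'k) mpolynomial"
    assume "p \<in> monomial_ideal V A" "q \<in> carrier (mpoly_ring V)"
    then have "q * p \<in> monomial_ideal V A" by (rule monomial_ideal_mult[OF assms, rotated])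
    then show "q \<otimes>\<^bsub>mpoly_ring V\<^esub> p \<in> monomial_ideal V A" "p \<otimes>\<^bsub>mpoly_ring V\<^esub> q \<in> monomial_ideal V A"
      by (simp_all add: mult.commute)
  qed (rule ring_axioms)
qed

lemma monomial_ideal_eq_genideal:
  fixes V :: "'v set"
  assumes "\<And>g. g \<in> G \<Longrightarrow> Poly_Mapping.keys g \<subseteq> V"
  shows "Idl\<^bsub>mpoly_ring V\<^esub> ((\<lambda>g. Poly_Mapping.single g (1::'k::field)) ` G)
      = monomial_ideal V {b + g | b g. g \<in> G \<and> Poly_Mapping.keys b \<subseteq> V}" (is "?L = monomial_ideal V ?A")
proof -
  interpret cring "mpoly_ring V :: ('v, 'k) mpolynomial ring" by (rule cring_mpoly_ring)
  let ?S = "(\<lambda>g. Poly_Mapping.single g (1::'k)) ` G"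
  have sub: "?S \<subseteq> carrier (mpoly_ring V)"
    using assms by fastforce
  have filt: "exponent_filter V ?A"
    unfolding exponent_filter_def
  proof safe
    fix b' b g :: "'v \<Rightarrow>\<^sub>0 nat"
    assume "Poly_Mapping.keys b' \<subseteq> V" "g \<in> G" "Poly_Mapping.keys b \<subseteq> V"
    then show "\<exists>c h. b' + (b + g) = c + h \<and> h \<in> G \<and> Poly_Mapping.keys c \<subseteq> V"
      by (intro exI[of _ "b' + b"] exI[of _ g]) (auto simp: keys_exponent_add add.assoc)
  qed
  have "g \<in> ?A" if "g \<in> G" for g
  proof -
    have "g = 0 + g" "Poly_Mapping.keys (0 :: 'v \<Rightarrow>\<^sub>0 nat) \<subseteq> V" by auto
    with that show ?thesis by blast
  qed
  then have "?S \<subseteq> monomial_ideal V ?A"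
    using assms by (auto intro!: single_in_monomial_ideal)
  then have "?L \<subseteq> monomial_ideal V ?A"
    by (intro genideal_minimal ideal_monomial_ideal filt)
  moreover have "p \<in> ?L" if p: "p \<in> monomial_ideal V ?A" for p
  proof (rule mem_if_monomials_mem)
    interpret I: ideal ?L "mpoly_ring V :: ('v, 'k) mpolynomial ring"
      by (rule genideal_ideal[OF sub])
    show "0 \<in> ?L" "\<And>p q. p \<in> ?L \<Longrightarrow> q \<in> ?L \<Longrightarrow> p + q \<in> ?L"
      using I.zero_closed I.a_closed by auto
    fix m assume "m \<in> Poly_Mapping.keys p"
    with p obtain b g where m: "m = b + g" "g \<in> G" "Poly_Mapping.keys b \<subseteq> V"
      by (auto simp: monomial_ideal_def)
    let ?c = "Poly_Mapping.lookup p m"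
    have "Poly_Mapping.single g 1 \<in> ?L"
      using genideal_self[OF sub] m by blast
    moreover have "Poly_Mapping.single b ?c \<in> carrier (mpoly_ring V)"
      using m by simp
    ultimately have "Poly_Mapping.single b ?c * Poly_Mapping.single g 1 \<in> ?L"
      using I.I_l_closed by force
    then show "Poly_Mapping.single m ?c \<in> ?L"
      by (simp add: mult_single m(1))
  qed
  ultimately show ?thesis by blast
qed

text \<open>A product of two polynomials only has exponents a + b. Conversely, the monomial with
  exponent a + b is a product of two monomials, which the support condition places in the
  ring.\<close>

lemma monomial_ideal_prod:
  fixes V :: "'v set"
  assumes filt: "exponent_filter V A" "exponent_filter V B"
    and sub: "\<And>m. m \<in> A \<union> B \<Longrightarrow> Poly_Mapping.keys m \<subseteq> V"
  shows "ideal_prod (mpoly_ring V) (monomial_ideal V A) (monomial_ideal V B)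
      = (monomial_ideal V {a + b | a b. a \<in> A \<and> b \<in> B} :: ('v, 'k::field) mpolynomial set)"
    (is "?L = monomial_ideal V ?C")
proof -
  interpret cring "mpoly_ring V :: ('v, 'k) mpolynomial ring" by (rule cring_mpoly_ring)
  have "p \<in> monomial_ideal V ?C" if "p \<in> ?L" for p
    using that
  proof (induction p rule: ideal_prod.induct)
    case (prod p q)
    have "Poly_Mapping.keys (p * q) \<subseteq> ?C"
      using keys_mult[of p q] prod unfolding monomial_ideal_def by blast
    then show ?case
      using prod mpoly_carrier_mult[of p V q] by (simp add: monomial_ideal_def)
  next
    case (sum p q)
    then show ?case by (simp add: monomial_ideal_add)
  qed
  moreover have "p \<in> ?L" if p: "p \<in> monomial_ideal V ?C" for p
  proof (rule mem_if_monomials_mem)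
    interpret I: ideal ?L "mpoly_ring V :: ('v, 'k) mpolynomial ring"
      by (intro ideal_prod_is_ideal ideal_monomial_ideal filt)
    show "0 \<in> ?L" "\<And>p q. p \<in> ?L \<Longrightarrow> q \<in> ?L \<Longrightarrow> p + q \<in> ?L"
      using I.zero_closed I.a_closed by auto
    fix m assume "m \<in> Poly_Mapping.keys p"
    with p obtain a b where m: "m = a + b" "a \<in> A" "b \<in> B"
      by (auto simp: monomial_ideal_def)
    let ?c = "Poly_Mapping.lookup p m"
    have "Poly_Mapping.single a ?c \<otimes>\<^bsub>mpoly_ring V\<^esub> Poly_Mapping.single b 1 \<in> ?L"
      using m sub by (intro ideal_prod.prod single_in_monomial_ideal) auto
    then show "Poly_Mapping.single m ?c \<in> ?L"
      by (simp add: mult_single m(1))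
  qed
  ultimately show ?thesis by blast
qed

section \<open>Prime ideals generated by variables\<close>

lemma variable_ideal_eq:
  assumes "F \<subseteq> V"
  shows "variable_ideal V F = monomial_ideal V {m. Poly_Mapping.keys m \<inter> F \<noteq> {}}" (is "_ = monomial_ideal V ?A")
proof -
  let ?G = "(\<lambda>i. Poly_Mapping.single i (1::nat)) ` F"
  have "variable_ideal V F = Idl\<^bsub>mpoly_ring V\<^esub> ((\<lambda>g. Poly_Mapping.single g 1) ` ?G)"
    by (simp add: variable_ideal_def mvar_def[abs_def] image_image)
  also have "\<dots> = monomial_ideal V {b + g | b g. g \<in> ?G \<and> Poly_Mapping.keys b \<subseteq> V}" (is "_ = monomial_ideal V ?B")
    using assms by (intro monomial_ideal_eq_genideal) auto
  also have "\<dots> = monomial_ideal V ?A"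
  proof -
    have "m \<in> ?B \<longleftrightarrow> m \<in> ?A" if m: "Poly_Mapping.keys m \<subseteq> V" for m
    proof
      assume "m \<in> ?A"
      then obtain i where i: "i \<in> Poly_Mapping.keys m" "i \<in> F" by blast
      then have "m = (m - Poly_Mapping.single i 1) + Poly_Mapping.single i 1"
        by (intro poly_mapping_eqI) (auto simp: lookup_add lookup_minus lookup_single in_keys_iff when_def)
      moreover have "Poly_Mapping.keys (m - Poly_Mapping.single i 1) \<subseteq> V"
        using m by (auto simp: in_keys_iff lookup_minus)
      ultimately show "m \<in> ?B" using i by blast
    qed (auto simp: keys_exponent_add)
    then show ?thesis by (force simp: monomial_ideal_def)
  qed
  finally show ?thesis .
qed

lemma exponent_filter_meets: "exponent_filter V {m. Poly_Mapping.keys m \<inter> F \<noteq> {}}"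
  by (auto simp: exponent_filter_def keys_exponent_add)

text \<open>Modulo P_F only the terms free of \<open>F\<close> survive, and a product of two
  polynomials free of \<open>F\<close> is free of \<open>F\<close>; if such a product lies in P_F,
  it is zero. The linear order on the variables orders the monomials, so that there are no zero
  divisors.\<close>

lemma primeideal_variable_ideal:
  fixes V :: "'v::linorder set"
  assumes "F \<subseteq> V"
  shows "primeideal (variable_ideal V F :: ('v, 'k::field) mpolynomial set) (mpoly_ring V)"
proof -
  interpret cring "mpoly_ring V :: ('v, 'k) mpolynomial ring" by (rule cring_mpoly_ring)
  let ?A = "{m. Poly_Mapping.keys m \<inter> F \<noteq> {}}"
  let ?P = "monomial_ideal V ?A :: ('v, 'k) mpolynomial set"
  interpret P: ideal ?P "mpoly_ring V"
    by (rule ideal_monomial_ideal[OF exponent_filter_meets])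
  have "primeideal ?P (mpoly_ring V)"
  proof (rule primeidealI)
    show "carrier (mpoly_ring V) \<noteq> ?P"
    proof
      assume "carrier (mpoly_ring V) = ?P"
      then have "1 \<in> ?P" using one_closed by simp
      then show False by (simp add: monomial_ideal_def)
    qed
    fix p q :: "('v, 'k) mpolynomial"
    assume pc: "p \<in> carrier (mpoly_ring V)" and qc: "q \<in> carrier (mpoly_ring V)"
      and "p \<otimes>\<^bsub>mpoly_ring V\<^esub> q \<in> ?P"
    then have pq: "p * q \<in> ?P" by simp
    obtain p0 p1 where p: "p = p0 + p1" "Poly_Mapping.keys p0 = Poly_Mapping.keys p - ?A"
      "Poly_Mapping.keys p1 = Poly_Mapping.keys p \<inter> ?A" by (rule split_keys)
    obtain q0 q1 where q: "q = q0 + q1" "Poly_Mapping.keys q0 = Poly_Mapping.keys q - ?A"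
      "Poly_Mapping.keys q1 = Poly_Mapping.keys q \<inter> ?A" by (rule split_keys)
    have "p1 \<in> ?P" "q1 \<in> ?P" "p0 \<in> carrier (mpoly_ring V)"
      using p q pc qc by (auto simp: monomial_ideal_def)
    then have "q * p1 \<in> ?P" "p0 * q1 \<in> ?P"
      using monomial_ideal_mult[OF exponent_filter_meets] qc by blast+
    then have "- (q * p1 + p0 * q1) \<in> ?P"
      using monomial_ideal_add[of "q * p1" V ?A "p0 * q1"] unfolding monomial_ideal_def
      by (simp del: minus_add_distrib)
    then have "p * q + - (q * p1 + p0 * q1) \<in> ?P"
      using pq monomial_ideal_add by blast
    moreover have "p * q + - (q * p1 + p0 * q1) = p0 * q0"
      by (simp add: p(1) q(1) algebra_simps)
    ultimately have "Poly_Mapping.keys (p0 * q0) \<subseteq> ?A"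
      by (simp add: monomial_ideal_def)
    moreover have "Poly_Mapping.keys (p0 * q0) \<inter> ?A = {}"
    proof -
      have "Poly_Mapping.keys (a + b) \<inter> F = {}"
        if "a \<in> Poly_Mapping.keys p0" "b \<in> Poly_Mapping.keys q0" for a b
        using that p(2) q(2) by (auto simp: keys_exponent_add)
      then show ?thesis using keys_mult[of p0 q0] by blast
    qed
    ultimately have "Poly_Mapping.keys (p0 * q0) = {}" by blast
    then have "p0 * q0 = 0" by simp
    then have "p0 = 0 \<or> q0 = 0" by simp
    then show "p \<in> ?P \<or> q \<in> ?P"
      using \<open>p1 \<in> ?P\<close> \<open>q1 \<in> ?P\<close> p(1) q(1) by auto
  qed (rule P.is_ideal, rule cring_axioms)
  then show ?thesis using variable_ideal_eq[OF assms] by metis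
qed

lemma variable_ideal_inj:
  assumes "F \<subseteq> V" "F' \<subseteq> V" "variable_ideal V F = (variable_ideal V F' :: ('v, 'k::field) mpolynomial set)"
  shows "F = F'"
proof -
  have "(mvar i :: ('v, 'k) mpolynomial) \<in> variable_ideal V F \<longleftrightarrow> i \<in> F" if "F \<subseteq> V" "i \<in> V" for i F
    using that by (simp add: variable_ideal_eq monomial_ideal_def mvar_def)
  with assms show ?thesis by blast
qed

section \<open>Associated primes as annihilators of monomials\<close>

lemma Max_keys_add_in_keys_mult:
  fixes p q :: "('v::linorder, 'k::field) mpolynomial"
  assumes "p \<noteq> 0" "q \<noteq> 0"
  shows "Max (Poly_Mapping.keys p) + Max (Poly_Mapping.keys q) \<in> Poly_Mapping.keys (p * q)"
proof -
  let ?a = "Max (Poly_Mapping.keys p)" and ?b = "Max (Poly_Mapping.keys q)"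
  have a: "?a \<in> Poly_Mapping.keys p" "\<And>m. m \<in> Poly_Mapping.keys p \<Longrightarrow> m \<le> ?a"
    and b: "?b \<in> Poly_Mapping.keys q" "\<And>m. m \<in> Poly_Mapping.keys q \<Longrightarrow> m \<le> ?b"
    using assms by auto
  obtain p0 p1 where p: "p = p0 + p1" "Poly_Mapping.keys p0 = Poly_Mapping.keys p - {?a}"
    "Poly_Mapping.keys p1 = Poly_Mapping.keys p \<inter> {?a}" by (rule split_keys)
  obtain q0 q1 where q: "q = q0 + q1" "Poly_Mapping.keys q0 = Poly_Mapping.keys q - {?b}"
    "Poly_Mapping.keys q1 = Poly_Mapping.keys q \<inter> {?b}" by (rule split_keys)
  \<comment> \<open>Any other pair of terms has exponents at most \<open>?a\<close> and
    \<open>?b\<close>, one of them strictly smaller, so only the two leading terms contribute to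
    \<open>?a + ?b\<close>.\<close>
  have *: "?a + ?b \<notin> Poly_Mapping.keys (p0 * q)"
  proof
    assume "?a + ?b \<in> Poly_Mapping.keys (p0 * q)"
    then obtain c d where cd: "?a + ?b = c + d" "c \<in> Poly_Mapping.keys p0" "d \<in> Poly_Mapping.keys q"
      using keys_mult[of p0 q] by blast
    with p(2) a b have "c < ?a" "d \<le> ?b" by (auto simp: less_le)
    then have "c + d < ?a + ?b" by (rule add_less_le_mono)
    with cd show False by simp
  qed
  have **: "?a + ?b \<notin> Poly_Mapping.keys (p1 * q0)"
  proof
    assume "?a + ?b \<in> Poly_Mapping.keys (p1 * q0)"
    then obtain c d where cd: "?a + ?b = c + d" "c \<in> Poly_Mapping.keys p1" "d \<in> Poly_Mapping.keys q0"
      using keys_mult[of p1 q0] by blast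
    with p(3) q(2) a b have "c = ?a" "d < ?b" by (auto simp: less_le)
    with cd show False by simp
  qed
  have "p1 \<noteq> 0" "q1 \<noteq> 0" using p q a b by auto
  then have "p1 * q1 \<noteq> 0" by simp
  then have "Poly_Mapping.keys (p1 * q1) \<noteq> {}" by simp
  moreover have "Poly_Mapping.keys (p1 * q1) \<subseteq> {?a + ?b}"
    using keys_mult[of p1 q1] p(3) q(3) by auto
  ultimately have "Poly_Mapping.keys (p1 * q1) = {?a + ?b}" by blast
  moreover have "p * q = p0 * q + (p1 * q0 + p1 * q1)"
    using p(1) q(1) by (simp add: algebra_simps)
  ultimately show ?thesis
    using * ** by (simp add: in_keys_iff lookup_add) blast
qed

text \<open>A prime annihilator over a monomial ideal is itself monomial: the leading monomial of
  each element lies in P, hence by subtraction all its monomials do. A prime monomial ideal is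
  generated by variables, and a single term x^m of \<open>f\<close> already has annihilator
  P.\<close>

lemma associated_primeE:
  fixes V :: "'v::linorder set" and P :: "('v, 'k::field) mpolynomial set"
  assumes filt: "exponent_filter V A"
    and P: "P \<in> associated_primes (mpoly_ring V) (monomial_ideal V A)"
  obtains F m where "F \<subseteq> V" "P = variable_ideal V F" "Poly_Mapping.keys m \<subseteq> V"
    "\<And>b. Poly_Mapping.keys b \<subseteq> V \<Longrightarrow> b + m \<in> A \<longleftrightarrow> Poly_Mapping.keys b \<inter> F \<noteq> {}"
proof -
  let ?R = "mpoly_ring V :: ('v, 'k) mpolynomial ring"
  let ?J = "monomial_ideal V A :: ('v, 'k) mpolynomial set"
  define ann where "ann f = {g \<in> carrier ?R. g * f \<in> ?J}" for f
  interpret P: primeideal P ?R using P by (simp add: associated_primes_def)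
  interpret J: ideal ?J ?R by (rule ideal_monomial_ideal[OF filt])
  have Pcarr: "p \<in> P \<Longrightarrow> p \<in> carrier ?R" for p by (rule P.Icarr)
  have Padd: "p + q \<in> P" if "p \<in> P" "q \<in> P" for p q
    using additive_subgroup.a_closed[OF ideal.axioms(1)[OF P.is_ideal] that] by simp
  have Pmult: "p * q \<in> P" if "p \<in> P" "q \<in> carrier ?R" for p q using P.I_r_closed[OF that] by simp
  have Pprime: "p \<in> P \<or> q \<in> P" if "p \<in> carrier ?R" "q \<in> carrier ?R" "p * q \<in> P" for p q
    using P.I_prime[of p q] that by simp
  have P1: "1 \<notin> P"
  proof
    assume "1 \<in> P"
    then have "P = carrier ?R" using P.one_imp_carrier by simp
    then show False using P.I_notcarr by simp
  qed
  have "\<exists>f. f \<in> carrier ?R \<and> P = ann f"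
    using P by (auto simp: associated_primes_def ann_def)
  then have "\<exists>f. (f \<in> carrier ?R \<and> P = ann f) \<and> (\<forall>g. g \<in> carrier ?R \<and> P = ann g
      \<longrightarrow> card (Poly_Mapping.keys f) \<le> card (Poly_Mapping.keys g))"
    by (elim exE) (rule ex_has_least_nat)
  \<comment> \<open>With \<open>f\<close> of minimal length, no term of \<open>f\<close> can be dropped by multiplying with a monomial
    outside \<open>P\<close>.\<close>
  then obtain f where f: "f \<in> carrier ?R" "P = ann f"
    and min: "\<And>g. g \<in> carrier ?R \<Longrightarrow> P = ann g \<Longrightarrow> card (Poly_Mapping.keys f) \<le> card (Poly_Mapping.keys g)"
    by (elim exE conjE) (simp del: mpoly_ring_simps)
  have colon: "Poly_Mapping.single b 1 \<in> P"
    if m: "m \<in> Poly_Mapping.keys f" and b: "Poly_Mapping.keys b \<subseteq> V" "b + m \<in> A" for m b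
  proof (rule ccontr)
    assume notin: "Poly_Mapping.single b 1 \<notin> P"
    let ?b = "Poly_Mapping.single b 1 :: ('v, 'k) mpolynomial"
    have bc: "?b \<in> carrier ?R" using b by simp
    obtain f0 f1 where fs: "f = f0 + f1" "Poly_Mapping.keys f0 = Poly_Mapping.keys f - {m}"
      "Poly_Mapping.keys f1 = Poly_Mapping.keys f \<inter> {m}" by (rule split_keys)
    have f0c: "f0 \<in> carrier ?R" and f1c: "f1 \<in> carrier ?R" using fs f by auto
    have keys: "Poly_Mapping.keys (?b * p) = (+) b ` Poly_Mapping.keys p" for p :: "('v, 'k) mpolynomial"
      by (rule single_times_monomial)
    have "?b * f1 \<in> ?J"
      using mpoly_carrier_mult[OF bc f1c] b m fs(3) by (simp add: monomial_ideal_def keys)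
    then have *: "g * (?b * f1) \<in> ?J" if "g \<in> carrier ?R" for g
      using monomial_ideal_mult[OF filt that] by blast
    have eq: "g * ?b * f = g * (?b * f0) + g * (?b * f1)" for g
      by (simp add: fs(1) algebra_simps)
    \<comment> \<open>The term at \<open>m\<close> is killed by x^b, and primality cancels x^b. So
      x^b times the remaining part of \<open>f\<close> has the same annihilator, but fewer
      terms.\<close>
    have "g \<in> P \<longleftrightarrow> g * (?b * f0) \<in> ?J" if g: "g \<in> carrier ?R" for g
    proof
      assume "g \<in> P"
      then have "g * f \<in> ?J" by (simp add: f(2) ann_def)
      then have "?b * (g * f) \<in> ?J" by (rule monomial_ideal_mult[OF filt bc])
      then have "g * ?b * f \<in> ?J" by (simp add: algebra_simps)
      moreover have "- (g * (?b * f1)) \<in> ?J"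
        using *[OF g] by (simp add: monomial_ideal_def)
      ultimately have "g * ?b * f + - (g * (?b * f1)) \<in> ?J" by (rule monomial_ideal_add)
      then show "g * (?b * f0) \<in> ?J" by (simp add: eq)
    next
      assume "g * (?b * f0) \<in> ?J"
      then have "g * ?b * f \<in> ?J" unfolding eq using *[OF g] by (rule monomial_ideal_add)
      then have "g * ?b \<in> P" using mpoly_carrier_mult[OF g bc] by (simp add: f(2) ann_def)
      with notin Pprime[OF g bc] show "g \<in> P" by blast
    qed
    then have "P = ann (?b * f0)" using Pcarr unfolding ann_def by blast
    then have "card (Poly_Mapping.keys f) \<le> card (Poly_Mapping.keys (?b * f0))"
      using min[OF mpoly_carrier_mult[OF bc f0c]] by blast
    also have "\<dots> \<le> card (Poly_Mapping.keys f0)" by (simp add: keys card_image_le)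
    also have "\<dots> < card (Poly_Mapping.keys f)" using m fs(2) by (intro psubset_card_mono) auto
    finally show False by simp
  qed
  have "f \<noteq> 0"
  proof
    assume "f = 0"
    then have "1 \<in> ann f" by (simp add: ann_def monomial_ideal_def)
    then show False using P1 f(2) by simp
  qed
  then obtain m where m: "m \<in> Poly_Mapping.keys f" by fastforce
  \<comment> \<open>Induction on the number of terms: the product of the leading monomials of p and
    \<open>f\<close> lies in the ideal, so \<open>colon\<close> puts the leading monomial of p into
    P. Removing that term leaves a shorter element of P.\<close>
  have terms: "Poly_Mapping.single k 1 \<in> P" if "p \<in> P" "k \<in> Poly_Mapping.keys p" for p k
    using that
  proof (induction "card (Poly_Mapping.keys p)" arbitrary: p rule: less_induct)
    case less
    let ?a = "Max (Poly_Mapping.keys p)"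
    have a: "?a \<in> Poly_Mapping.keys p" using less.prems by (intro Max_in) auto
    have "p \<noteq> 0" using less.prems by auto
    then have "?a + Max (Poly_Mapping.keys f) \<in> Poly_Mapping.keys (p * f)"
      by (rule Max_keys_add_in_keys_mult[OF _ \<open>f \<noteq> 0\<close>])
    moreover have "p * f \<in> ?J" using less.prems by (simp add: f(2) ann_def)
    ultimately have "?a + Max (Poly_Mapping.keys f) \<in> A" by (auto simp: monomial_ideal_def)
    moreover have "Max (Poly_Mapping.keys f) \<in> Poly_Mapping.keys f" using m by (intro Max_in) auto
    moreover have "Poly_Mapping.keys ?a \<subseteq> V" using Pcarr[OF less.prems(1)] a by simp
    ultimately have top: "Poly_Mapping.single ?a 1 \<in> P" using colon by blast
    show ?case
    proof (cases "k = ?a")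
      case False
      obtain p0 p1 where ps: "p = p0 + p1" "Poly_Mapping.keys p0 = Poly_Mapping.keys p - {?a}"
        "Poly_Mapping.keys p1 = Poly_Mapping.keys p \<inter> {?a}" by (rule split_keys)
      have "k \<notin> Poly_Mapping.keys p1" if "k \<noteq> ?a" for k using ps(3) that by blast
      then have "p1 = Poly_Mapping.single ?a (Poly_Mapping.lookup p1 ?a)"
        by (intro poly_mapping_eqI) (simp add: lookup_single when_def not_in_keys_iff_lookup_eq_zero)
      also have "\<dots> = Poly_Mapping.single ?a 1 * Poly_Mapping.single 0 (Poly_Mapping.lookup p1 ?a)"
        by (simp add: mult_single)
      finally have p1: "p1 = Poly_Mapping.single ?a 1 * Poly_Mapping.single 0 (Poly_Mapping.lookup p1 ?a)" .
      have "Poly_Mapping.single ?a 1 * Poly_Mapping.single 0 (- Poly_Mapping.lookup p1 ?a) \<in> P"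
        using top by (rule Pmult) simp
      then have "p + Poly_Mapping.single ?a 1 * Poly_Mapping.single 0 (- Poly_Mapping.lookup p1 ?a) \<in> P"
        using less.prems(1) Padd by blast
      moreover have "p + Poly_Mapping.single ?a 1 * Poly_Mapping.single 0 (- Poly_Mapping.lookup p1 ?a) = p0"
        by (subst ps(1), subst (1) p1) (simp add: mult_single flip: single_add)
      ultimately have "p0 \<in> P" by simp
      moreover have "card (Poly_Mapping.keys p0) < card (Poly_Mapping.keys p)"
        using a ps(2) by (intro psubset_card_mono) auto
      ultimately show ?thesis using less.hyps[of p0] ps(2) less.prems False by blast
    qed (use top in simp)
  qed
  define F where "F = {i \<in> V. mvar i \<in> P}"
  \<comment> \<open>Primality lets membership of a monomial be tested one variable at a
    time.\<close>
  have mono: "Poly_Mapping.single b 1 \<in> P \<longleftrightarrow> Poly_Mapping.keys b \<inter> F \<noteq> {}"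
    if "Poly_Mapping.keys b \<subseteq> V" for b
    using that
  proof (induction b rule: exponent_induct)
    case zero
    then show ?case using P1 by simp
  next
    case (add i b)
    have i: "i \<in> V" and b: "Poly_Mapping.keys b \<subseteq> V" using add.prems by (auto simp: keys_exponent_add)
    have eq: "Poly_Mapping.single (Poly_Mapping.single i 1 + b) 1 = mvar i * (Poly_Mapping.single b 1 :: ('v, 'k) mpolynomial)"
      by (simp add: mvar_def mult_single)
    have c: "mvar i \<in> carrier ?R" "Poly_Mapping.single b 1 \<in> carrier ?R"
      using i b by (simp_all add: mvar_def)
    have "Poly_Mapping.single (Poly_Mapping.single i 1 + b) 1 \<in> P
        \<longleftrightarrow> mvar i \<in> P \<or> Poly_Mapping.single b 1 \<in> P"
      unfolding eq using Pprime[OF c] Pmult[OF _ c(2)] Pmult[OF _ c(1)]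
      by (metis mult.commute)
    then show ?case using add.IH[OF b] i by (auto simp: keys_exponent_add F_def)
  qed
  have FV: "F \<subseteq> V" by (auto simp: F_def)
  have "p \<in> P \<longleftrightarrow> p \<in> variable_ideal V F" for p
  proof
    assume p: "p \<in> P"
    then have "Poly_Mapping.keys k \<inter> F \<noteq> {}" if "k \<in> Poly_Mapping.keys p" for k
      using terms[OF p that] mono Pcarr[OF p] that by auto
    then show "p \<in> variable_ideal V F"
      using Pcarr[OF p] by (auto simp: variable_ideal_eq[OF FV] monomial_ideal_def)
  next
    assume p: "p \<in> variable_ideal V F"
    show "p \<in> P"
    proof (rule mem_if_monomials_mem)
      show "0 \<in> P"
        using additive_subgroup.zero_closed[OF ideal.axioms(1)[OF P.is_ideal]] by simp
    next
      fix k assume "k \<in> Poly_Mapping.keys p"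
      then have k: "Poly_Mapping.keys k \<subseteq> V" "Poly_Mapping.keys k \<inter> F \<noteq> {}"
        using p by (auto simp: variable_ideal_eq[OF FV] monomial_ideal_def)
      then have "Poly_Mapping.single k 1 \<in> P" by (simp add: mono)
      then have "Poly_Mapping.single k 1 * Poly_Mapping.single 0 (Poly_Mapping.lookup p k) \<in> P"
        by (rule Pmult) simp
      then show "Poly_Mapping.single k (Poly_Mapping.lookup p k) \<in> P" by (simp add: mult_single)
    qed (rule Padd)
  qed
  then have "P = variable_ideal V F" by blast
  moreover have "Poly_Mapping.keys m \<subseteq> V" using m f(1) by simp
  moreover have "b + m \<in> A \<longleftrightarrow> Poly_Mapping.keys b \<inter> F \<noteq> {}" if b: "Poly_Mapping.keys b \<subseteq> V" for b
  proof
    assume "b + m \<in> A"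
    then show "Poly_Mapping.keys b \<inter> F \<noteq> {}" using colon[OF m b] mono[OF b] by blast
  next
    assume "Poly_Mapping.keys b \<inter> F \<noteq> {}"
    then have "Poly_Mapping.single b 1 \<in> P" using mono[OF b] by blast
    then have "Poly_Mapping.single b 1 * f \<in> ?J" by (simp add: f(2) ann_def)
    then have "(+) b ` Poly_Mapping.keys f \<subseteq> A" by (simp add: monomial_ideal_def single_times_monomial)
    then show "b + m \<in> A" using m by blast
  qed
  ultimately show ?thesis using FV by (intro that[of F m]) auto
qed

text \<open>The monomial x^m itself has annihilator P_F modulo the ideal, because multiplication by
  it shifts every exponent of g by m.\<close>

lemma variable_ideal_associated_prime:
  fixes V :: "'v::linorder set"
  assumes FV: "F \<subseteq> V" and filt: "exponent_filter V A" and mV: "Poly_Mapping.keys m \<subseteq> V"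
    and m: "\<And>b. Poly_Mapping.keys b \<subseteq> V \<Longrightarrow> b + m \<in> A \<longleftrightarrow> Poly_Mapping.keys b \<inter> F \<noteq> {}"
  shows "(variable_ideal V F :: ('v, 'k::field) mpolynomial set)
    \<in> associated_primes (mpoly_ring V) (monomial_ideal V A)"
proof -
  let ?m = "Poly_Mapping.single m 1 :: ('v, 'k) mpolynomial"
  have mc: "?m \<in> carrier (mpoly_ring V)" using mV by simp
  have "g \<in> variable_ideal V F \<longleftrightarrow> g * ?m \<in> monomial_ideal V A" if g: "g \<in> carrier (mpoly_ring V)"
    for g :: "('v, 'k) mpolynomial"
  proof -
    have "g * ?m \<in> monomial_ideal V A \<longleftrightarrow> (\<forall>b\<in>Poly_Mapping.keys g. b + m \<in> A)"
      using mpoly_carrier_mult[OF g mc] single_times_monomial[of m g]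
      by (auto simp: monomial_ideal_def mult.commute add.commute simp del: mpoly_ring_simps(1))
    also have "\<dots> \<longleftrightarrow> (\<forall>b\<in>Poly_Mapping.keys g. Poly_Mapping.keys b \<inter> F \<noteq> {})"
      using g m by simp
    finally show ?thesis using g by (auto simp: variable_ideal_eq[OF FV] monomial_ideal_def)
  qed
  moreover have "g \<in> carrier (mpoly_ring V)" if "g \<in> variable_ideal V F" for g :: "('v, 'k) mpolynomial"
    using that by (simp add: variable_ideal_eq[OF FV] monomial_ideal_def)
  ultimately have "variable_ideal V F = {g \<in> carrier (mpoly_ring V). g * ?m \<in> monomial_ideal V A}"
    by blast
  with mc have "\<exists>f \<in> carrier (mpoly_ring V :: ('v, 'k) mpolynomial ring).
      variable_ideal V F = {g \<in> carrier (mpoly_ring V). g \<otimes>\<^bsub>mpoly_ring V\<^esub> f \<in> monomial_ideal V A}"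
    unfolding mpoly_ring_simps(2) by (intro bexI[of _ ?m])
  with primeideal_variable_ideal[OF FV] show ?thesis
    unfolding associated_primes_def by blast
qed

section \<open>Maximum packings of edges\<close>

text \<open>An edge is a two-element set of vertices, and \<open>edge_degree M v\<close> is the exponent of \<open>x\<^sub>v\<close> in the product
  of the edge monomials of the multiset \<open>M\<close>.\<close>

definition edge_degree :: "'v set multiset \<Rightarrow> 'v \<Rightarrow> nat" where
  "edge_degree M v = size {#e \<in># M. v \<in> e#}"

lemma edge_degree_simps [simp]:
  "edge_degree {#} v = 0"
  "edge_degree (add_mset e M) v = of_bool (v \<in> e) + edge_degree M v"
  "edge_degree (M + N) v = edge_degree M v + edge_degree N v"
  by (simp_all add: edge_degree_def)

lemma edge_degree_diff:
  assumes "q \<subseteq># M"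
  shows "edge_degree (M - q) v + edge_degree q v = edge_degree M v"
  using assms by (metis edge_degree_simps(3) subset_mset.diff_add)

lemma edge_degree_eq_0_iff: "edge_degree M v = 0 \<longleftrightarrow> (\<forall>e\<in>#M. v \<notin> e)"
  by (induction M) auto

lemma edge_degree_less_ex:
  assumes "edge_degree M x < edge_degree N x"
  obtains e where "x \<in> e" "count M e < count N e"
proof -
  have "\<not> {#e \<in># N. x \<in> e#} \<subseteq># {#e \<in># M. x \<in> e#}"
    using assms size_mset_mono[of "{#e \<in># N. x \<in> e#}" "{#e \<in># M. x \<in> e#}"] by (auto simp: edge_degree_def)
  then obtain e where "count {#e \<in># N. x \<in> e#} e > count {#e \<in># M. x \<in> e#} e"
    by (auto simp: subseteq_mset_def not_le)
  then show ?thesis by (intro that[of e]) (auto split: if_splits)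
qed

lemma rtrancl_comp_imp_even_relpow:
  assumes "(x, y) \<in> (R O R)\<^sup>*"
  shows "\<exists>k. even k \<and> (x, y) \<in> R ^^ k"
  using assms
proof (induction rule: rtrancl_induct)
  case base
  show ?case by (intro exI[of _ 0]) simp
next
  case (step y z)
  then obtain k where "even k" "(x, y) \<in> R ^^ k" by blast
  with step.hyps show ?case by (intro exI[of _ "Suc (Suc k)"]) auto
qed

section \<open>Edge packings and alternating walks\<close>

locale edge_set =
  fixes E :: "'v set set"
  assumes edge_pair: "e \<in> E \<Longrightarrow> \<exists>i j. i \<noteq> j \<and> e = {i, j}"
begin

text \<open>In terms of monomials: the product of the edges in \<open>M\<close> divides x^a.\<close>

definition packing :: "('v \<Rightarrow> nat) \<Rightarrow> 'v set multiset \<Rightarrow> bool" where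
  "packing a M \<longleftrightarrow> set_mset M \<subseteq> E \<and> (\<forall>v. edge_degree M v \<le> a v)"

lemma edge_neq: "{x, y} \<in> E \<Longrightarrow> x \<noteq> y"
  using edge_pair by fastforce

lemma no_loop [simp]: "{x} \<notin> E"
  using edge_neq[of x x] by auto

lemma edge_other:
  assumes "e \<in> E" "x \<in> e"
  obtains y where "e = {x, y}" "x \<noteq> y"
  using edge_pair[OF assms(1)] assms(2) by auto

lemma of_bool_edge:
  "{x, y} \<in> E \<Longrightarrow> of_bool (v \<in> {x, y}) = of_bool (v = x) + (of_bool (v = y) :: nat)"
  by (auto dest: edge_neq)

text \<open>Walks of even length in which vertices and edges may repeat. The edges in
  \<open>p\<close> are meant to enter a packing and those in \<open>q\<close> to leave it.\<close>

inductive alternating :: "'v \<Rightarrow> 'v \<Rightarrow> 'v set multiset \<Rightarrow> 'v set multiset \<Rightarrow> bool" where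
  alternating_refl: "alternating x x {#} {#}"
| alternating_step: "{x, y} \<in> E \<Longrightarrow> {y, z} \<in> E \<Longrightarrow> alternating z w p q
    \<Longrightarrow> alternating x w (add_mset {x, y} p) (add_mset {y, z} q)"

text \<open>Each inner passage of the walk contributes one edge of \<open>p\<close> and one of
  \<open>q\<close>, so only the ends change: the exchange moves a free unit from x to z.\<close>

lemma alternating_edge_degree:
  "alternating x z p q \<Longrightarrow> edge_degree p v + of_bool (v = z) = edge_degree q v + of_bool (v = x)"
proof (induction rule: alternating.induct)
  case (alternating_step x y z w p q)
  then show ?case
    unfolding edge_degree_simps of_bool_edge[OF alternating_step.hyps(1)] of_bool_edge[OF alternating_step.hyps(2)]
    by linarith
qed simp

lemma alternating_size: "alternating x z p q \<Longrightarrow> size p = size q"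
  by (induction rule: alternating.induct) auto

lemma alternating_edges: "alternating x z p q \<Longrightarrow> set_mset p \<subseteq> E \<and> set_mset q \<subseteq> E"
  by (induction rule: alternating.induct) auto

lemma alternating_single:
  "{x, y} \<in> E \<Longrightarrow> {y, z} \<in> E \<Longrightarrow> alternating x z {#{x, y}#} {#{y, z}#}"
  using alternating_step[OF _ _ alternating_refl] by simp

end

section \<open>Maximum packings and the vertices they miss\<close>

locale packing_bound = edge_set E for E :: "'v set set" +
  fixes a :: "'v \<Rightarrow> nat" and t :: nat
  assumes bound: "packing a M \<Longrightarrow> size M \<le> t"
begin

text \<open>Sizes are compared with the bound \<open>t\<close> itself: a packing of size
  \<open>t\<close> is maximum, and if \<open>t\<close> is not attained there is no optimal
  packing.\<close>

definition optimal :: "'v set multiset \<Rightarrow> bool" where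
  "optimal M \<longleftrightarrow> packing a M \<and> size M = t"

definition missed :: "'v \<Rightarrow> bool" where
  "missed x \<longleftrightarrow> (\<exists>M. optimal M \<and> edge_degree M x < a x)"

definition missed_edges :: "('v \<times> 'v) set" where
  "missed_edges = {(i, j). missed i \<and> missed j \<and> {i, j} \<in> E}"

text \<open>Stated with the degree balance instead of a walk, so that it also covers exchanges
  involving the closing edge of a blossom.\<close>

lemma optimal_switch:
  assumes "optimal M" "q \<subseteq># M" "set_mset p \<subseteq> E" "size p = size q"
    and balance: "\<And>v. edge_degree p v + of_bool (v = z) = edge_degree q v + of_bool (v = x)" and "edge_degree M x < a x"
  shows "optimal (M - q + p)" "edge_degree (M - q + p) z < a z"
proof -
  have d: "edge_degree (M - q + p) v + of_bool (v = z) = edge_degree M v + of_bool (v = x)" for v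
    using edge_degree_diff[OF assms(2), of v] balance[of v] by simp
  have le: "edge_degree M v \<le> a v" for v using assms(1) by (simp add: optimal_def packing_def)
  have "edge_degree (M - q + p) v \<le> a v" for v
    using d[of v] le[of v] assms(6) by (cases "v = x") auto
  moreover have "set_mset (M - q) \<subseteq> E"
    using assms(1) by (auto simp: optimal_def packing_def dest: in_diffD)
  moreover have "size (M - q + p) = size M"
  proof -
    have "size (M - q) + size q = size M"
      using assms(2) by (metis size_union subset_mset.diff_add)
    with assms(4) show ?thesis by simp
  qed
  ultimately show "optimal (M - q + p)"
    using assms(1,3) by (simp add: optimal_def packing_def)
  show "edge_degree (M - q + p) z < a z"
    using d[of z] le[of z] assms(6) by (cases "z = x") auto
qed

text \<open>The trail grows two edges at a time. If M' saturates x, it has a surplus edge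
  \<open>e\<close> at x, and M then has a surplus edge \<open>f\<close> at the other end of
  \<open>e\<close>. Exchanging \<open>f\<close> for \<open>e\<close> in M moves the gap on to z and
  shrinks M' - M, so the process stops at a vertex missed by M'.\<close>

lemma alternating_trail:
  assumes "optimal M" "optimal M'" "edge_degree M x < a x"
  shows "\<exists>z p q. alternating x z p q \<and> p \<subseteq># M' - M \<and> q \<subseteq># M - M' \<and> edge_degree M' z < a z"
  using assms
proof (induction "size (M' - M)" arbitrary: M x rule: less_induct)
  case less
  have le: "edge_degree M v \<le> a v" "edge_degree M' v \<le> a v" for v
    using less.prems by (simp_all add: optimal_def packing_def)
  show ?case
  proof (cases "edge_degree M' x < a x")
    case True
    then show ?thesis by (intro exI[of _ x] exI[of _ "{#}"]) (simp add: alternating_refl)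
  next
    case False
    with less.prems obtain e where e: "x \<in> e" "count M e < count M' e"
      using edge_degree_less_ex[of M x M'] by auto
    then have "e \<in># M'" by (simp flip: count_greater_zero_iff)
    then have eE: "e \<in> E" using less.prems by (auto simp: optimal_def packing_def)
    with e obtain y where y: "e = {x, y}" "x \<noteq> y" using edge_other by metis
    have "\<not> edge_degree M y < a y"
    proof
      assume "edge_degree M y < a y"
      then have "packing a (add_mset e M)"
        using less.prems le eE y by (auto simp: optimal_def packing_def of_bool_def Suc_le_eq)
      then show False using bound less.prems by (fastforce simp: optimal_def)
    qed
    then have "edge_degree M' y \<le> edge_degree M y" using le(2)[of y] by simp
    moreover have "edge_degree (M' - {#e#}) y + 1 = edge_degree M' y"
      using edge_degree_diff[of "{#e#}" M' y] \<open>e \<in># M'\<close> y by simp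
    \<comment> \<open>Removing one copy of \<open>e\<close> from M' makes the comparison at y
      strict. Since \<open>e\<close> is still at least as frequent there as in M, \<open>f\<close>
      differs from \<open>e\<close>.\<close>
    ultimately obtain f where f: "y \<in> f" "count (M' - {#e#}) f < count M f"
      using edge_degree_less_ex[of "M' - {#e#}" y M] by auto
    then have fe: "f \<noteq> e" "count M' f < count M f" using e by (auto split: if_splits)
    then have "f \<in># M" by (simp flip: count_greater_zero_iff)
    then have fE: "f \<in> E" using less.prems by (auto simp: optimal_def packing_def)
    with f obtain z where z: "f = {y, z}" "y \<noteq> z" using edge_other by metis
    have "alternating x z {#e#} {#f#}"
      using alternating_single eE fE y z by simp
    then have M1: "optimal (M - {#f#} + {#e#})" "edge_degree (M - {#f#} + {#e#}) z < a z"
      using optimal_switch[OF less.prems(1), of "{#f#}" "{#e#}" z x] alternating_edge_degree[of x z "{#e#}" "{#f#}"]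
        \<open>f \<in># M\<close> eE less.prems(3) by auto
    define M1 where "M1 = M - {#f#} + {#e#}"
    \<comment> \<open>The differences lose exactly one \<open>e\<close> and one \<open>f\<close>, so
      the trail found for the new packing extends inside the original differences.\<close>
    have d1: "add_mset e (M' - M1) = M' - M"
      using e fe \<open>f \<in># M\<close> by (intro multiset_eqI) (auto simp: M1_def)
    have d2: "add_mset f (M1 - M') = M - M'"
      using e fe \<open>f \<in># M\<close> by (intro multiset_eqI) (auto simp: M1_def)
    have "size (M' - M1) < size (M' - M)" by (simp flip: d1)
    then obtain w p q where "alternating z w p q" "p \<subseteq># M' - M1" "q \<subseteq># M1 - M'" "edge_degree M' w < a w"
      using less.hyps[of M1 z] M1 less.prems(2) unfolding M1_def by blast
    then show ?thesis
      using eE fE y(1) z(1)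
      by (intro exI[of _ w] exI[of _ "add_mset e p"] exI[of _ "add_mset f q"])
        (auto simp flip: d1 d2 intro: alternating_step)
  qed
qed

text \<open>The edge closing an alternating walk makes it a blossom: the vertices in odd position can be
  missed by switching the part of the walk behind them together with the closing edge.\<close>

lemma blossom:
  assumes "alternating x w p q" "optimal N" "edge_degree N x < a x" "q \<subseteq># N"
    and M: "optimal M" "edge_degree M u < a u" "{u, w} \<in> E" and "q \<subseteq># M"
  shows "(x, w) \<in> (missed_edges O missed_edges)\<^sup>*"
  using assms(1-4,7,8)
proof (induction arbitrary: N rule: alternating.induct)
  case (alternating_step x y z w p q)
  let ?q = "add_mset {y, z} q"
  have "q \<subseteq># ?q" by simp
  with alternating_step.prems(5) have qM: "q \<subseteq># M" by (rule subset_mset.trans[rotated])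
  have yz: "{#{y, z}#} \<subseteq># N" and qN: "q \<subseteq># N - {#{y, z}#}"
    using alternating_step.prems(3) by (simp_all add: insert_subset_eq_iff)
  have x: "missed x" using alternating_step.prems by (auto simp: missed_def)
  have dp: "edge_degree p v + of_bool (v = w) = edge_degree q v + of_bool (v = z)" for v
    by (rule alternating_edge_degree) fact
  have "size p = size q" by (rule alternating_size) fact
  have pE: "set_mset p \<subseteq> E" using alternating_edges alternating_step.hyps(3) by blast
  \<comment> \<open>The running packing N is exchanged along the first two edges and then misses z;
    M stays fixed and is kept for the closing edge.\<close>
  have "optimal (N - {#{y, z}#} + {#{x, y}#})" "edge_degree (N - {#{y, z}#} + {#{x, y}#}) z < a z"
    using optimal_switch[OF alternating_step.prems(1) yz _ _
        alternating_edge_degree[OF alternating_single] alternating_step.prems(2)] alternating_step.hyps(1,2)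
    by simp_all
  moreover have "q \<subseteq># N - {#{y, z}#} + {#{x, y}#}"
    using qN by (meson mset_subset_eq_add_left subset_mset.trans)
  ultimately have IH: "missed z" "(z, w) \<in> (missed_edges O missed_edges)\<^sup>*"
    using alternating_step.IH[of "N - {#{y, z}#} + {#{x, y}#}"] qM alternating_step.prems(4) by (auto simp: missed_def)
  \<comment> \<open>From the gap of M at u, cross the closing edge to w and follow the walk
    backwards to y. This even walk moves the gap to y.\<close>
  have "edge_degree (add_mset {u, w} p) v + of_bool (v = y) = edge_degree ?q v + of_bool (v = u)" for v
    unfolding edge_degree_simps of_bool_edge[OF alternating_step.prems(4)] of_bool_edge[OF alternating_step.hyps(2)]
    using dp[of v] by linarith
  then have "optimal (M - ?q + add_mset {u, w} p)" "edge_degree (M - ?q + add_mset {u, w} p) y < a y"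
    using optimal_switch[OF M(1) alternating_step.prems(5), of "add_mset {u, w} p" y u]
      M(2) alternating_step.prems(4) pE \<open>size p = size q\<close> by simp_all
  then have "missed y" by (auto simp: missed_def)
  then have "(x, z) \<in> missed_edges O missed_edges"
    using x IH(1) alternating_step.hyps by (auto simp: missed_edges_def)
  with IH(2) show ?case by (simp add: converse_rtrancl_into_rtrancl)
qed simp

text \<open>A trail from a packing missing u to one missing w must end in w, and by
  \<open>blossom\<close> it runs through missed vertices. The edge from w to u closes this even walk
  to an odd one.\<close>

lemma odd_closed_walk:
  assumes "missed u" "missed w" and E: "{u, w} \<in> E"
  shows "\<exists>k. odd k \<and> (u, u) \<in> missed_edges ^^ k"
proof -
  obtain M M' where M: "optimal M" "edge_degree M u < a u" and M': "optimal M'" "edge_degree M' w < a w"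
    using assms by (auto simp: missed_def)
  obtain z p q where pq: "alternating u z p q" "p \<subseteq># M' - M" "q \<subseteq># M - M'" "edge_degree M' z < a z"
    using alternating_trail[OF M(1) M'(1) M(2)] by blast
  have sub: "p \<subseteq># M'" "q \<subseteq># M" using pq by (meson diff_subset_eq_self subset_mset.trans)+
  have "z = w"
  proof (rule ccontr)
    assume "z \<noteq> w"
    \<comment> \<open>Reading the trail backwards in M' frees u, and w stays free as z differs from
      w. Then {u, w} could be added, exceeding the bound.\<close>
    have dq: "edge_degree q v + of_bool (v = u) = edge_degree p v + of_bool (v = z)" for v
      using alternating_edge_degree[OF pq(1), of v] by simp
    have "optimal (M' - p + q)" "edge_degree (M' - p + q) u < a u"
      using optimal_switch[OF M'(1) sub(1) _ _ dq pq(4)]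
        alternating_edges[OF pq(1)] alternating_size[OF pq(1)] by simp_all
    moreover have "edge_degree (M' - p + q) w < a w"
      using edge_degree_diff[OF sub(1), of w] dq[of w] \<open>z \<noteq> w\<close> edge_neq[OF E] M'(2) by auto
    ultimately have "packing a (add_mset {u, w} (M' - p + q))" "size (M' - p + q) = t"
      using E by (auto simp: optimal_def packing_def of_bool_def Suc_le_eq)
    then show False using bound by fastforce
  qed
  with pq have "(u, w) \<in> (missed_edges O missed_edges)\<^sup>*"
    using blossom[of u w p q M M u] M E sub(2) by blast
  then obtain k where "even k" "(u, w) \<in> missed_edges ^^ k"
    using rtrancl_comp_imp_even_relpow by metis
  moreover have "(w, u) \<in> missed_edges"
    using assms by (simp add: missed_edges_def insert_commute)
  ultimately have "(u, u) \<in> missed_edges ^^ Suc k" by (intro relpow_Suc_I)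
  with \<open>even k\<close> show ?thesis by (intro exI[of _ "Suc k"]) simp
qed

end

section \<open>The combinatorial condition extracted from a colon ideal\<close>

context edge_set begin

definition edges_on :: "'v set \<Rightarrow> ('v \<times> 'v) set" where
  "edges_on U = {(i, j). i \<in> U \<and> j \<in> U \<and> {i, j} \<in> E}"

text \<open>Relational form of the condition on U in the theorem: odd cycles in components become
  reachable odd closed walks, the first and third clauses put N[U] into F, and the last one is
  minimality of F above N[U] when F is a cover. For U empty it describes minimal covers.\<close>

definition odd_core :: "'v set \<Rightarrow> 'v set \<Rightarrow> bool" where
  "odd_core F U \<longleftrightarrow> U \<subseteq> F
    \<and> (\<forall>u\<in>U. \<exists>x k. (u, x) \<in> (edges_on U)\<^sup>* \<and> odd k \<and> (x, x) \<in> edges_on U ^^ k)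
    \<and> (\<forall>u\<in>U. \<forall>j. {u, j} \<in> E \<longrightarrow> j \<in> F)
    \<and> (\<forall>i\<in>F. i \<in> U \<or> (\<exists>u\<in>U. {u, i} \<in> E) \<or> (\<exists>j. j \<notin> F \<and> {i, j} \<in> E))"

text \<open>Variables outside F never help to pack t + 1 edges, while each single variable of F
  does. Hence F is exactly the set of neighbours of the missed vertices, and the core consists of
  the missed vertices with a missed neighbour.\<close>

lemma odd_core_exists:
  assumes upper: "\<And>c M. (\<And>i. c i \<noteq> 0 \<Longrightarrow> i \<in> \<Union>E - F) \<Longrightarrow> packing (\<lambda>v. a v + c v) M \<Longrightarrow> size M \<le> t"
    and lower: "\<And>i. i \<in> F \<Longrightarrow> \<exists>M. packing (\<lambda>v. a v + of_bool (v = i)) M \<and> size M = Suc t"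
  shows "(\<forall>e\<in>E. e \<inter> F \<noteq> {}) \<and> (\<exists>U. odd_core F U)"
proof
  show "\<forall>e\<in>E. e \<inter> F \<noteq> {}"
  proof
    fix e assume e: "e \<in> E"
    show "e \<inter> F \<noteq> {}"
    proof
      assume "e \<inter> F = {}"
      \<comment> \<open>Raising both ends of an edge outside F by t + 1 would make room for t + 1
        copies of it.\<close>
      let ?M = "replicate_mset (Suc t) e"
      have "edge_degree (replicate_mset n e) v = (if v \<in> e then n else 0)" for v n
        by (induction n) auto
      then have "packing (\<lambda>v. a v + (if v \<in> e then Suc t else 0)) ?M"
        using e by (auto simp: packing_def)
      then have "size ?M \<le> t"
        using e \<open>e \<inter> F = {}\<close> by (intro upper[of "\<lambda>v. if v \<in> e then Suc t else 0"]) (auto split: if_splits)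
      then show False by simp
    qed
  qed
  interpret packing_bound E a t
    using upper[of "\<lambda>_. 0"] by unfold_locales auto
  \<comment> \<open>A packing of size t + 1 that needs one more unit at i uses an edge at i;
    deleting that edge leaves a maximum packing missing its other end.\<close>
  have F: "\<exists>j. missed j \<and> {i, j} \<in> E" if "i \<in> F" for i
  proof -
    from lower[OF that] obtain M where M: "packing (\<lambda>v. a v + of_bool (v = i)) M" "size M = Suc t" by blast
    then have le: "edge_degree M v \<le> a v + of_bool (v = i)" for v by (simp add: packing_def)
    have "\<exists>e\<in>#M. i \<in> e"
    proof (rule ccontr)
      assume "\<not> (\<exists>e\<in>#M. i \<in> e)"
      then have "edge_degree M i = 0" by (simp add: edge_degree_eq_0_iff)
      then have "edge_degree M v \<le> a v" for v using le[of v] by (cases "v = i") auto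
      then have "packing a M" using M(1) by (simp add: packing_def)
      then show False using bound M(2) by fastforce
    qed
    then obtain e where e: "e \<in># M" "i \<in> e" by blast
    then have eE: "e \<in> E" using M(1) by (auto simp: packing_def)
    then obtain j where j: "e = {i, j}" "i \<noteq> j" using edge_other e(2) by metis
    have d: "edge_degree (M - {#e#}) v + of_bool (v \<in> e) = edge_degree M v" for v
      using edge_degree_diff[of "{#e#}" M v] e(1) by simp
    have "edge_degree (M - {#e#}) v \<le> a v" for v
      using d[of v] le[of v] e(2) by (cases "v = i") auto
    then have "optimal (M - {#e#})"
      using M e(1) by (auto simp: optimal_def packing_def size_Diff_singleton dest: in_diffD)
    moreover have "edge_degree (M - {#e#}) j < a j"
      using d[of j] le[of j] j by auto
    ultimately show ?thesis using eE j by (auto simp: missed_def)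
  qed
  \<comment> \<open>If i were outside F, one more unit at i would let {j, i} be added to a maximum
    packing missing j, against \<open>upper\<close>.\<close>
  have nbr: "i \<in> F" if "missed j" "{j, i} \<in> E" for i j
  proof (rule ccontr)
    assume "i \<notin> F"
    from that obtain M where M: "optimal M" "edge_degree M j < a j" by (auto simp: missed_def)
    then have "packing (\<lambda>v. a v + of_bool (v = i)) (add_mset {j, i} M)"
      using that(2) edge_neq[OF that(2)] by (auto simp: optimal_def packing_def of_bool_def)
    then have "size (add_mset {j, i} M) \<le> t"
      using \<open>i \<notin> F\<close> that(2) by (intro upper[of "\<lambda>v. of_bool (v = i)"]) auto
    then show False using M by (simp add: optimal_def)
  qed
  define U where "U = {u. missed u \<and> (\<exists>w. missed w \<and> {u, w} \<in> E)}"
  have "missed_edges \<subseteq> edges_on U"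
    by (auto simp: missed_edges_def edges_on_def U_def insert_commute)
  then have pow: "missed_edges ^^ k \<subseteq> edges_on U ^^ k" for k
    by (induction k) (auto intro: relcomp_mono)
  have "odd_core F U"
    unfolding odd_core_def
  proof (intro conjI ballI allI impI)
    show "U \<subseteq> F" using nbr by (auto simp: U_def insert_commute)
    fix u assume u: "u \<in> U"
    then show "\<exists>x k. (u, x) \<in> (edges_on U)\<^sup>* \<and> odd k \<and> (x, x) \<in> edges_on U ^^ k"
      using odd_closed_walk[of u] pow unfolding U_def by blast
    fix j assume "{u, j} \<in> E"
    with u show "j \<in> F" using nbr by (auto simp: U_def)
  next
    fix i assume "i \<in> F"
    then obtain j where j: "missed j" "{i, j} \<in> E" using F by blast
    show "i \<in> U \<or> (\<exists>u\<in>U. {u, i} \<in> E) \<or> (\<exists>j. j \<notin> F \<and> {i, j} \<in> E)"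
    proof (cases "j \<in> F")
      case True
      \<comment> \<open>A missed vertex in F has a missed neighbour itself, so it belongs to
        U.\<close>
      then have "j \<in> U" using F j by (auto simp: U_def)
      then show ?thesis using j by (auto simp: insert_commute)
    qed (use j in auto)
  qed
  then show "\<exists>U. odd_core F U" ..
qed

end

section \<open>Exponent vectors from odd cycles\<close>

lemma edge_degree_replicate_mset [simp]: "edge_degree (replicate_mset n e) v = n * of_bool (v \<in> e)"
  by (induction n) auto

lemma sum_of_bool_mem: "finite C \<Longrightarrow> (\<Sum>v\<in>C. of_bool (v \<in> e)) = card (C \<inter> e)"
  by (simp add: sum_of_bool_eq Int_def)

text \<open>The end y is left out of the list, so that for y = x the list names the closed walk
  cyclically.\<close>

lemma relpow_imp_list:
  assumes "(x, y) \<in> R ^^ k"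
  shows "\<exists>xs. length xs = k \<and> set xs \<subseteq> R\<^sup>* `` {x} \<and> successively (\<lambda>u v. (u, v) \<in> R) (xs @ [y]) \<and> hd (xs @ [y]) = x"
  using assms
proof (induction k arbitrary: x)
  case (Suc k)
  then obtain z where z: "(x, z) \<in> R" "(z, y) \<in> R ^^ k" using relpow_Suc_D2 by metis
  with Suc.IH obtain xs where xs: "length xs = k" "set xs \<subseteq> R\<^sup>* `` {z}"
    "successively (\<lambda>u v. (u, v) \<in> R) (xs @ [y])" "hd (xs @ [y]) = z" by blast
  have "R\<^sup>* `` {z} \<subseteq> R\<^sup>* `` {x}" using z(1) by (auto intro: converse_rtrancl_into_rtrancl)
  then show ?case
    using xs z(1) by (intro exI[of _ "x # xs"]) (auto simp: successively_Cons)
qed simp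

section \<open>Near-perfect exponent vectors on a component\<close>

context edge_set begin

text \<open>Take every second edge of the walk; repeated vertices are counted with
  multiplicity.\<close>

lemma matched_path:
  assumes "successively (\<lambda>x y. {x, y} \<in> E) xs" "even (length xs)"
  shows "\<exists>M. set_mset M \<subseteq> E \<and> (\<forall>v. edge_degree M v = count_list xs v)"
  using assms
proof (induction xs rule: induct_list012)
  case (3 x y xs)
  then have xy: "{x, y} \<in> E" and "successively (\<lambda>x y. {x, y} \<in> E) xs" "even (length xs)"
    by (auto simp: successively_Cons)
  with "3.IH"(1) obtain M where "set_mset M \<subseteq> E" "\<forall>v. edge_degree M v = count_list xs v" by blast
  with xy show ?case
    using edge_neq[OF xy] by (intro exI[of _ "add_mset {x, y} M"]) auto
qed (auto intro: exI[of _ "{#}"])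

text \<open>The analogue with multiplicities of the factor-critical graphs of Gallai--Edmonds
  theory.\<close>

definition near_perfect :: "('v \<Rightarrow> nat) \<Rightarrow> 'v set \<Rightarrow> bool" where
  "near_perfect a S \<longleftrightarrow>
     (\<forall>j\<in>S. \<exists>M. set_mset M \<subseteq> E \<and> (\<forall>v. edge_degree M v + of_bool (v = j) = a v))"

text \<open>Cutting the cyclic sequence at an occurrence of j leaves a walk with an even number of
  vertices, running from behind j round to just before it.\<close>

lemma near_perfect_cycle:
  assumes "successively (\<lambda>x y. {x, y} \<in> E) xs" "{last xs, hd xs} \<in> E" "odd (length xs)"
  shows "near_perfect (count_list xs) (set xs)"
  unfolding near_perfect_def
proof
  fix j assume "j \<in> set xs"
  then obtain ys zs where xs: "xs = ys @ j # zs" by (auto simp: in_set_conv_decomp)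
  have "successively (\<lambda>x y. {x, y} \<in> E) (zs @ ys)"
    using assms(1,2) unfolding xs
    by (cases "ys = []"; cases "zs = []") (auto simp: successively_append_iff successively_Cons)
  moreover have "even (length (zs @ ys))" using assms(3) by (simp add: xs)
  ultimately obtain M where "set_mset M \<subseteq> E" "\<forall>v. edge_degree M v = count_list (zs @ ys) v"
    using matched_path by blast
  then show "\<exists>M. set_mset M \<subseteq> E \<and> (\<forall>v. edge_degree M v + of_bool (v = j) = count_list xs v)"
    by (intro exI[of _ M]) (auto simp: xs)
qed

text \<open>If the removed unit is in S, the new edge {j, k} completes the old decomposition. If it
  is at k, take the old decomposition that leaves out z, and let {z, j} use that unit of z and the
  additional unit of j.\<close>

lemma near_perfect_insert:
  assumes np: "near_perfect a S" and S: "z \<in> S" "j \<in> S" and zj: "{z, j} \<in> E" and jk: "{j, k} \<in> E"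
  shows "near_perfect (\<lambda>v. a v + of_bool (v \<in> {j, k})) (insert k S)"
  unfolding near_perfect_def
proof
  fix i assume i: "i \<in> insert k S"
  show "\<exists>M. set_mset M \<subseteq> E \<and> (\<forall>v. edge_degree M v + of_bool (v = i) = a v + of_bool (v \<in> {j, k}))"
  proof (cases "i \<in> S")
    case True
    with np obtain M where "set_mset M \<subseteq> E" "\<forall>v. edge_degree M v + of_bool (v = i) = a v"
      unfolding near_perfect_def by blast
    with jk show ?thesis
      by (intro exI[of _ "add_mset {j, k} M"]) (simp flip: \<open>\<forall>v. edge_degree M v + of_bool (v = i) = a v\<close>)
  next
    case False
    with i have [simp]: "i = k" by simp
    from np S obtain M where M: "set_mset M \<subseteq> E" "\<forall>v. edge_degree M v + of_bool (v = z) = a v"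
      unfolding near_perfect_def by blast
    have "edge_degree (add_mset {z, j} M) v + of_bool (v = i) = a v + of_bool (v \<in> {j, k})" for v
      unfolding edge_degree_simps of_bool_edge[OF zj] of_bool_edge[OF jk] using M(2)[rule_format, of v] by simp
    with M zj show ?thesis by (intro exI[of _ "add_mset {z, j} M"]) simp
  qed
qed

text \<open>Start with the vertices of the odd closed walk; \<open>near_perfect_insert\<close>
  absorbs one neighbour at a time until the whole component is reached.\<close>

lemma near_perfect_component:
  assumes "finite U" "odd k" "(x, x) \<in> edges_on U ^^ k"
  defines "C \<equiv> (edges_on U)\<^sup>* `` {x}"
  obtains a y z where "near_perfect a C" "\<And>v. a v \<noteq> 0 \<Longrightarrow> v \<in> C" "finite C" "y \<in> C" "z \<in> C" "{y, z} \<in> E"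
proof -
  let ?R = "edges_on U"
  obtain xs where xs: "length xs = k" "set xs \<subseteq> C" "successively (\<lambda>u v. (u, v) \<in> ?R) (xs @ [x])"
    "hd (xs @ [x]) = x" using relpow_imp_list[OF assms(3)] by (auto simp: C_def)
  then have ne: "xs \<noteq> []" using assms(2) by auto
  have sub: "C \<subseteq> insert x U"
  proof
    fix v assume "v \<in> C"
    then have "(x, v) \<in> ?R\<^sup>*" by (simp add: C_def)
    then show "v \<in> insert x U" by (cases rule: rtranclE) (auto simp: edges_on_def)
  qed
  then have finC: "finite C" using assms(1) finite_subset by auto
  \<comment> \<open>The clause on neighbours inside S supplies the vertex z required by
    \<open>near_perfect_insert\<close>.\<close>
  define good where "good S \<longleftrightarrow> S \<subseteq> C \<and> x \<in> S \<and> (\<forall>j\<in>S. \<exists>z\<in>S. {z, j} \<in> E)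
    \<and> (\<exists>a. near_perfect a S \<and> (\<forall>v. a v \<noteq> 0 \<longrightarrow> v \<in> S))" for S
  have "successively (\<lambda>u v. {u, v} \<in> E) (xs @ [x])"
    using xs(3) by (rule successively_mono) (auto simp: edges_on_def)
  then have cyc: "successively (\<lambda>u v. {u, v} \<in> E) xs" "{last xs, hd xs} \<in> E"
    using ne xs(4) by (auto simp: successively_append_iff)
  have "good (set xs)"
    unfolding good_def
  proof (intro conjI ballI)
    show "x \<in> set xs" using ne xs(4) hd_in_set by fastforce
    show "\<exists>a. near_perfect a (set xs) \<and> (\<forall>v. a v \<noteq> 0 \<longrightarrow> v \<in> set xs)"
      using near_perfect_cycle[OF cyc] assms(2) xs(1)
      by (intro exI[of _ "count_list xs"]) (auto simp: count_list_0_iff)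
    fix j assume "j \<in> set xs"
    then obtain ys zs where j: "xs = ys @ j # zs" by (auto simp: in_set_conv_decomp)
    show "\<exists>z\<in>set xs. {z, j} \<in> E"
    proof (cases "ys = []")
      case True
      then have "{last xs, j} \<in> E" using cyc(2) j by simp
      then show ?thesis using ne last_in_set by blast
    next
      case False
      then have "{last ys, j} \<in> E" using cyc(1) j by (simp add: successively_append_iff)
      then show ?thesis using False j by auto
    qed
  qed (rule xs(2))
  moreover have "finite {S. good S}"
    using finC by (rule finite_subset[rotated, OF finite_Pow_iff[THEN iffD2]]) (auto simp: good_def)
  ultimately obtain S where S: "good S" and max: "\<And>S'. good S' \<Longrightarrow> S \<subseteq> S' \<Longrightarrow> S = S'"
    using finite_has_maximal[of "{S. good S}"] by auto
  \<comment> \<open>A maximal good set is closed under the edges of the induced graph.\<close>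
  have "v \<in> S" if "(x, v) \<in> ?R\<^sup>*" for v
    using that
  proof (induction rule: rtrancl_induct)
    case base
    show ?case using S by (simp add: good_def)
  next
    case (step j k)
    then have jk: "{j, k} \<in> E" by (simp add: edges_on_def)
    obtain z where z: "z \<in> S" "{z, j} \<in> E" using S step.IH by (auto simp: good_def)
    obtain a where a: "near_perfect a S" "\<And>v. a v \<noteq> 0 \<Longrightarrow> v \<in> S" using S by (auto simp: good_def)
    have "k \<in> C" using step.hyps by (auto simp: C_def)
    have "good (insert k S)"
      unfolding good_def
    proof (intro conjI exI[of _ "\<lambda>v. a v + of_bool (v \<in> {j, k})"] allI impI)
      show "insert k S \<subseteq> C" "x \<in> insert k S" using S \<open>k \<in> C\<close> by (auto simp: good_def)
      show "\<forall>i\<in>insert k S. \<exists>z\<in>insert k S. {z, i} \<in> E"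
        using S jk step.IH by (auto simp: good_def)
      show "near_perfect (\<lambda>v. a v + of_bool (v \<in> {j, k})) (insert k S)"
        using a(1) z(1) step.IH z(2) jk by (rule near_perfect_insert)
      fix v assume "a v + of_bool (v \<in> {j, k}) \<noteq> 0"
      then show "v \<in> insert k S" using a(2)[of v] step.IH by auto
    qed
    then show ?case using max by blast
  qed
  with S have "S = C" by (auto simp: good_def C_def)
  with S have "good C" by simp
  then show ?thesis using that finC unfolding good_def by blast
qed

section \<open>Vectors with known packing number and their sums over components\<close>

definition block :: "'v set \<Rightarrow> ('v \<Rightarrow> nat) \<Rightarrow> nat \<Rightarrow> bool" where
  "block U a s \<longleftrightarrow> (\<forall>v. a v \<noteq> 0 \<longrightarrow> v \<in> U) \<and> (\<forall>M. packing a M \<longrightarrow> size M \<le> s)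
    \<and> (\<exists>M. packing a M \<and> size M = s)
    \<and> (\<forall>j\<in>U. \<exists>M. packing a M \<and> size M = s \<and> edge_degree M j < a j)"

lemma sum_edge_degree:
  assumes "finite C" "set_mset M \<subseteq> E" "\<And>e. e \<in># M \<Longrightarrow> e \<subseteq> C"
  shows "(\<Sum>v\<in>C. edge_degree M v) = 2 * size M"
  using assms(2,3)
proof (induction M)
  case (add e M)
  then obtain i j where e: "e = {i, j}" "i \<noteq> j" using edge_pair[of e] by auto
  have "(\<Sum>v\<in>C. of_bool (v \<in> e) :: nat) = card (C \<inter> e)"
    using assms(1) by (rule sum_of_bool_mem)
  also have "C \<inter> e = e" using add.prems(2)[of e] by auto
  finally have "(\<Sum>v\<in>C. of_bool (v \<in> e) :: nat) = 2" using e by simp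
  moreover have "(\<Sum>v\<in>C. edge_degree M v) = 2 * size M" using add by simp
  ultimately show ?case by (simp add: sum.distrib del: sum_of_bool_eq)
qed simp

lemma support_edge:
  assumes "packing a M" "\<And>v. a v \<noteq> 0 \<Longrightarrow> v \<in> C" "e \<in># M"
  shows "e \<subseteq> C"
proof
  fix v assume "v \<in> e"
  then have "edge_degree M v \<noteq> 0" using assms(3) by (auto simp: edge_degree_eq_0_iff)
  then have "a v \<noteq> 0" using assms(1) by (metis le_zero_eq packing_def)
  then show "v \<in> C" by (rule assms(2))
qed

text \<open>Counting degrees, a total of 2s + 1 bounds every packing by s, and each decomposition
  leaving out one unit has exactly s edges.\<close>

lemma near_perfect_block:
  assumes np: "near_perfect a C" and "finite C" "C \<noteq> {}" and supp: "\<And>v. a v \<noteq> 0 \<Longrightarrow> v \<in> C"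
    and sum: "sum a C = 2 * s + 1"
  shows "block C a s"
proof -
  have M: "\<exists>M. packing a M \<and> size M = s \<and> edge_degree M j < a j" if "j \<in> C" for j
  proof -
    obtain M where M: "set_mset M \<subseteq> E" "\<And>v. edge_degree M v + of_bool (v = j) = a v"
      using np \<open>j \<in> C\<close> unfolding near_perfect_def by blast
    then have "edge_degree M v \<le> a v" for v by (metis le_add1)
    with M(1) have pack: "packing a M" by (simp add: packing_def)
    have "sum a C = (\<Sum>v\<in>C. edge_degree M v) + (\<Sum>v\<in>C. of_bool (v = j))"
      by (simp add: M(2) flip: sum.distrib)
    also have "(\<Sum>v\<in>C. of_bool (v = j) :: nat) = 1"
      using \<open>finite C\<close> \<open>j \<in> C\<close> by (simp add: of_bool_def)
    also have "(\<Sum>v\<in>C. edge_degree M v) = 2 * size M"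
      using support_edge[OF pack supp] M(1) \<open>finite C\<close> by (intro sum_edge_degree) auto
    finally have "size M = s" using sum by simp
    moreover have "edge_degree M j < a j" using M(2)[of j] by simp
    ultimately show ?thesis using pack by blast
  qed
  have "size M \<le> s" if "packing a M" for M
  proof -
    have "2 * size M = (\<Sum>v\<in>C. edge_degree M v)"
      using support_edge[OF that supp] that \<open>finite C\<close> by (intro sum_edge_degree[symmetric]) (auto simp: packing_def)
    also have "\<dots> \<le> sum a C" using that by (intro sum_mono) (simp add: packing_def)
    finally show ?thesis using sum by simp
  qed
  with M supp \<open>C \<noteq> {}\<close> show ?thesis unfolding block_def by blast
qed

text \<open>Extra copies of an edge inside the component keep the vector near-perfect and raise its
  packing number by one each, which reaches all large s.\<close>

lemma component_block:
  assumes "finite U" "odd k" "(x, x) \<in> edges_on U ^^ k"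
  shows "\<exists>s0. \<forall>s\<ge>s0. \<exists>a. block ((edges_on U)\<^sup>* `` {x}) a s"
proof -
  let ?C = "(edges_on U)\<^sup>* `` {x}"
  obtain a y z where a: "near_perfect a ?C" "\<And>v. a v \<noteq> 0 \<Longrightarrow> v \<in> ?C" and fin: "finite ?C"
    and yz: "y \<in> ?C" "z \<in> ?C" "{y, z} \<in> E"
    using near_perfect_component[OF assms] by blast
  have np: "near_perfect (\<lambda>v. a v + d * of_bool (v \<in> {y, z})) ?C" for d
    unfolding near_perfect_def
  proof
    fix j assume "j \<in> ?C"
    with a(1) obtain M where M: "set_mset M \<subseteq> E" "\<And>v. edge_degree M v + of_bool (v = j) = a v"
      unfolding near_perfect_def by blast
    with yz(3) show "\<exists>M. set_mset M \<subseteq> E \<and> (\<forall>v. edge_degree M v + of_bool (v = j) = a v + d * of_bool (v \<in> {y, z}))"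
      by (intro exI[of _ "M + replicate_mset d {y, z}"]) (simp flip: M(2) split: if_splits)
  qed
  \<comment> \<open>Leaving out a unit at y gives a sum of edges, so the total is odd.\<close>
  have "\<exists>s. sum a ?C = 2 * s + 1"
  proof -
    obtain M where M: "set_mset M \<subseteq> E" "\<And>v. edge_degree M v + of_bool (v = y) = a v"
      using a(1) yz(1) unfolding near_perfect_def by blast
    then have "packing a M" unfolding packing_def by (metis le_add1)
    then have "e \<subseteq> ?C" if "e \<in># M" for e using support_edge a(2) that by blast
    then have "(\<Sum>v\<in>?C. edge_degree M v) = 2 * size M" using sum_edge_degree[OF fin M(1)] by blast
    moreover have "sum a ?C = (\<Sum>v\<in>?C. edge_degree M v) + (\<Sum>v\<in>?C. of_bool (v = y))"
      by (simp add: M(2) flip: sum.distrib)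
    moreover have "(\<Sum>v\<in>?C. of_bool (v = y) :: nat) = 1"
      using fin yz(1) by (simp add: of_bool_def)
    ultimately show ?thesis by (intro exI[of _ "size M"]) simp
  qed
  then obtain s0 where s0: "sum a ?C = 2 * s0 + 1" by blast
  have "block ?C (\<lambda>v. a v + d * of_bool (v \<in> {y, z})) (s0 + d)" for d
  proof (rule near_perfect_block[OF np fin])
    have "(\<Sum>v\<in>?C. of_bool (v \<in> {y, z})) = card (?C \<inter> {y, z})"
      using fin by (rule sum_of_bool_mem)
    also have "?C \<inter> {y, z} = {y, z}" using yz by auto
    finally have "(\<Sum>v\<in>?C. of_bool (v \<in> {y, z})) = (2 :: nat)" using edge_neq[OF yz(3)] by simp
    then show "(\<Sum>v\<in>?C. a v + d * of_bool (v \<in> {y, z})) = 2 * (s0 + d) + 1"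
      unfolding sum.distrib sum_distrib_left[symmetric] s0 by simp
  next
    fix v assume "a v + d * of_bool (v \<in> {y, z}) \<noteq> 0"
    then show "v \<in> ?C" using a(2)[of v] yz by (auto split: if_splits)
  qed (use yz in blast)
  note blk = this
  have "\<exists>a. block ?C a s" if "s \<ge> s0" for s
    using blk[of "s - s0"] that by auto
  then show ?thesis by (intro exI[of _ s0]) simp
qed

text \<open>No edge joins the two parts, so every packing splits and the maximum sizes add up. A
  vertex of one part is missed by combining a suitable packing there with any maximum packing on the
  other.\<close>

lemma block_Un:
  assumes b: "block U a s" "block W b t" and "U \<inter> W = {}"
    and cross: "\<And>i j. i \<in> U \<Longrightarrow> j \<in> W \<Longrightarrow> {i, j} \<notin> E"
  shows "block (U \<union> W) (\<lambda>v. a v + b v) (s + t)"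
proof -
  have supp: "a v \<noteq> 0 \<Longrightarrow> v \<in> U" "b v \<noteq> 0 \<Longrightarrow> v \<in> W" for v using b by (auto simp: block_def)
  have join: "packing (\<lambda>v. a v + b v) (M + N)" if "packing a M" "packing b N" for M N
    using that by (auto simp: packing_def intro: add_mono)
  have "size M \<le> s + t" if M: "packing (\<lambda>v. a v + b v) M" for M
  proof -
    have e: "e \<subseteq> U \<or> e \<subseteq> W" if "e \<in># M" for e
    proof -
      have "e \<subseteq> U \<union> W" using M _ that by (rule support_edge) (use supp in auto)
      moreover have "e \<in> E" using M that by (auto simp: packing_def)
      then obtain i j where "e = {i, j}" using edge_pair by blast
      ultimately show ?thesis
        using cross[of i j] cross[of j i] \<open>e \<in> E\<close> by (auto simp: insert_commute)
    qed
    let ?M1 = "{#e \<in># M. e \<subseteq> U#}" and ?M2 = "{#e \<in># M. \<not> e \<subseteq> U#}"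
    have le: "edge_degree ?M1 v + edge_degree ?M2 v \<le> a v + b v" for v
      using M by (simp add: packing_def flip: edge_degree_simps(3))
    have "edge_degree ?M1 v \<le> a v" for v
    proof (cases "v \<in> U")
      case True
      then have "b v = 0" using supp(2)[of v] \<open>U \<inter> W = {}\<close> by auto
      then show ?thesis using le[of v] by simp
    next
      case False
      then have "edge_degree ?M1 v = 0" by (auto simp: edge_degree_eq_0_iff)
      then show ?thesis by simp
    qed
    then have "packing a ?M1" using M by (auto simp: packing_def)
    moreover have "edge_degree ?M2 v \<le> b v" for v
    proof (cases "v \<in> W")
      case True
      then have "a v = 0" using supp(1)[of v] \<open>U \<inter> W = {}\<close> by auto
      then show ?thesis using le[of v] by simp
    next
      case False
      then have "edge_degree ?M2 v = 0" using e by (auto simp: edge_degree_eq_0_iff)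
      then show ?thesis by simp
    qed
    then have "packing b ?M2" using M by (auto simp: packing_def)
    ultimately have "size ?M1 \<le> s" "size ?M2 \<le> t" using b by (auto simp: block_def)
    moreover have "size M = size ?M1 + size ?M2" by (metis multiset_partition size_union)
    ultimately show ?thesis by simp
  qed
  moreover obtain M N where MN: "packing a M" "size M = s" "packing b N" "size N = t"
    using b by (auto simp: block_def)
  moreover have "\<exists>L. packing (\<lambda>v. a v + b v) L \<and> size L = s + t \<and> edge_degree L j < a j + b j" if "j \<in> U \<union> W" for j
  proof (cases "j \<in> U")
    case True
    with b obtain M' where M': "packing a M'" "size M' = s" "edge_degree M' j < a j" by (auto simp: block_def)
    then have "edge_degree (M' + N) j < a j + b j" using MN by (auto simp: packing_def intro: add_less_le_mono)
    with M' MN join show ?thesis by (intro exI[of _ "M' + N"]) simp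
  next
    case False
    with that b obtain N' where N': "packing b N'" "size N' = t" "edge_degree N' j < b j" by (auto simp: block_def)
    then have "edge_degree (M + N') j < a j + b j" using MN by (auto simp: packing_def intro: add_le_less_mono)
    with N' MN join show ?thesis by (intro exI[of _ "M + N'"]) simp
  qed
  ultimately show ?thesis
    using supp join[OF MN(1,3)] unfolding block_def by (auto intro: exI[of _ "M + N"])
qed

lemma block_Union:
  assumes fin: "finite \<C>" "\<C> \<noteq> {}"
    and ex: "\<And>C. C \<in> \<C> \<Longrightarrow> \<exists>s0. \<forall>s\<ge>s0. \<exists>a. block C a s"
    and disj: "\<And>C D. C \<in> \<C> \<Longrightarrow> D \<in> \<C> \<Longrightarrow> C \<noteq> D \<Longrightarrow> C \<inter> D = {}"
    and cross: "\<And>C D i j. C \<in> \<C> \<Longrightarrow> D \<in> \<C> \<Longrightarrow> C \<noteq> D \<Longrightarrow> i \<in> C \<Longrightarrow> j \<in> D \<Longrightarrow> {i, j} \<notin> E"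
  shows "\<exists>s0. \<forall>s\<ge>s0. \<exists>a. block (\<Union>\<C>) a s"
proof -
  have "\<exists>s0. \<forall>s\<ge>s0. \<exists>a. block (\<Union>\<D>) a s" if "finite \<D>" "\<D> \<noteq> {}" "\<D> \<subseteq> \<C>" for \<D>
    using that
  proof (induction \<D> rule: finite_ne_induct)
    case (singleton C)
    then show ?case using ex[of C] by simp
  next
    case (insert C \<D>)
    then have "\<exists>s0. \<forall>s\<ge>s0. \<exists>a. block (\<Union>\<D>) a s" by simp
    then obtain s0 where s0: "\<forall>s\<ge>s0. \<exists>a. block (\<Union>\<D>) a s" by (elim exE)
    have C: "C \<in> \<C>" and D: "D \<in> \<C>" "C \<noteq> D" if "D \<in> \<D>" for D using insert that by auto
    obtain c a where a: "block C a c" using ex[of C] insert.prems by auto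
    have dis: "C \<inter> \<Union>\<D> = {}"
    proof -
      have "C \<inter> D = {}" if "D \<in> \<D>" for D using disj[OF C D] that by simp
      then show ?thesis by auto
    qed
    have cr: "{i, j} \<notin> E" if i: "i \<in> C" and j: "j \<in> \<Union>\<D>" for i j
    proof -
      obtain D where "D \<in> \<D>" "j \<in> D" using j by auto
      then show ?thesis using cross[OF C D i] by simp
    qed
    \<comment> \<open>The new component keeps one fixed block of size \<open>c\<close>; the
      remaining ones take up s - c.\<close>
    have "\<exists>b. block (\<Union>(insert C \<D>)) b s" if "s \<ge> c + s0" for s
    proof -
      have "s - c \<ge> s0" using that by simp
      with s0 obtain b where b: "block (\<Union>\<D>) b (s - c)" by metis
      have "block (C \<union> \<Union>\<D>) (\<lambda>v. a v + b v) (c + (s - c))"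
        using a b dis cr by (rule block_Un)
      then have "block (\<Union>(insert C \<D>)) (\<lambda>v. a v + b v) s" using that by simp
      then show ?thesis by (intro exI)
    qed
    then show ?case by (intro exI[of _ "c + s0"]) simp
  qed
  from this[OF fin subset_refl] show ?thesis .
qed

lemma block_odd_core:
  assumes "finite U" "U \<noteq> {}"
    and odd: "\<And>u. u \<in> U \<Longrightarrow> \<exists>x k. (u, x) \<in> (edges_on U)\<^sup>* \<and> odd k \<and> (x, x) \<in> edges_on U ^^ k"
  shows "\<exists>s0. \<forall>s\<ge>s0. \<exists>a. block U a s"
proof -
  let ?R = "edges_on U"
  let ?\<C> = "(\<lambda>u. ?R\<^sup>* `` {u}) ` U"
  have "sym ?R" by (auto simp: sym_def edges_on_def insert_commute)
  then have sym: "(v, u) \<in> ?R\<^sup>*" if "(u, v) \<in> ?R\<^sup>*" for u v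
    using that by (metis sym_rtrancl symD)
  have eq: "?R\<^sup>* `` {u} = ?R\<^sup>* `` {v}" if "(u, v) \<in> ?R\<^sup>*" for u v
    using sym[OF that] that by (auto intro: rtrancl_trans)
  have "v \<in> U" if "(u, v) \<in> ?R\<^sup>*" "u \<in> U" for u v
    using that by (cases rule: rtranclE) (auto simp: edges_on_def)
  then have UC: "\<Union>?\<C> = U" by auto
  have "\<exists>s0. \<forall>s\<ge>s0. \<exists>a. block (\<Union>?\<C>) a s"
  proof (rule block_Union)
    fix C assume "C \<in> ?\<C>"
    then obtain u where u: "u \<in> U" "C = ?R\<^sup>* `` {u}" by blast
    with odd obtain x k where "(u, x) \<in> ?R\<^sup>*" "odd k" "(x, x) \<in> ?R ^^ k" by blast
    with u show "\<exists>s0. \<forall>s\<ge>s0. \<exists>a. block C a s"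
      using component_block[OF assms(1)] eq by metis
  next
    fix C D assume "C \<in> ?\<C>" "D \<in> ?\<C>" "C \<noteq> D"
    then show dis: "C \<inter> D = {}" using eq by blast
    fix i j assume i: "i \<in> C" and j: "j \<in> D"
    show "{i, j} \<notin> E"
    proof
      assume "{i, j} \<in> E"
      moreover have "i \<in> U" "j \<in> U" using i j \<open>C \<in> ?\<C>\<close> \<open>D \<in> ?\<C>\<close> UC by blast+
      ultimately have "(i, j) \<in> ?R" by (simp add: edges_on_def)
      then have "j \<in> C" using i \<open>C \<in> ?\<C>\<close> by (auto intro: rtrancl_into_rtrancl)
      with j dis show False by blast
    qed
  qed (use assms in auto)
  then show ?thesis by (simp only: UC)
qed

text \<open>This says that \<open>(I\<^bsup>t+1\<^esup> : x\<^sup>a) = P\<^sub>F\<close>.\<close>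

definition witness :: "'v set \<Rightarrow> 'v set \<Rightarrow> ('v \<Rightarrow> nat) \<Rightarrow> nat \<Rightarrow> bool" where
  "witness V F a t \<longleftrightarrow> (\<forall>v. a v \<noteq> 0 \<longrightarrow> v \<in> V)
    \<and> (\<forall>c M. (\<forall>i. c i \<noteq> 0 \<longrightarrow> i \<in> V - F) \<longrightarrow> packing (\<lambda>v. a v + c v) M \<longrightarrow> size M \<le> t)
    \<and> (\<forall>i\<in>F. \<exists>M. packing (\<lambda>v. a v + of_bool (v = i)) M \<and> size M = Suc t)"

section \<open>Witnesses for all large powers\<close>

lemma witness_minimal_cover:
  assumes V: "F \<subseteq> V" "\<Union>E \<subseteq> V" "finite V" and cover: "\<forall>e\<in>E. e \<inter> F \<noteq> {}" and core: "odd_core F {}"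
  shows "\<exists>a. witness V F a t"
proof (cases "F = {}")
  case True
  then have "E = {}" using cover by auto
  then have "M = {#}" if "packing c M" for c M
    using that unfolding packing_def by simp
  then have "witness V F (\<lambda>_. 0) t" using True unfolding witness_def by force
  then show ?thesis by blast
next
  case False
  then obtain i0 where i0: "i0 \<in> F" by blast
  have nbr: "\<exists>j. j \<notin> F \<and> {i, j} \<in> E" if "i \<in> F" for i using core that by (auto simp: odd_core_def)
  \<comment> \<open>The supply inside F is t units at a single vertex. Every edge consumes a unit in
    F, which bounds packings by t. Outside F there are t + 1 units at each vertex, enough to match
    the t units and one more unit at any i in F to neighbours outside F.\<close>
  define a where "a v = t * of_bool (v = i0) + Suc t * of_bool (v \<in> V - F)" for v
  have "size M \<le> t" if c: "\<forall>i. c i \<noteq> 0 \<longrightarrow> i \<in> V - F" and M: "packing (\<lambda>v. a v + c v) M" for c M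
  proof -
    have finF: "finite F" using V finite_subset by blast
    have "size M \<le> (\<Sum>v\<in>F. edge_degree M v)"
    proof -
      have "set_mset M \<subseteq> E" using M by (simp add: packing_def)
      then show ?thesis
      proof (induction M)
        case (add e M)
        then obtain v where v: "v \<in> e" "v \<in> F" using cover by auto
        then have "1 \<le> (\<Sum>v\<in>F. of_bool (v \<in> e) :: nat)"
          using member_le_sum[of v F "\<lambda>v. of_bool (v \<in> e) :: nat"] finF by simp
        with add show ?case by (simp add: sum.distrib)
      qed simp
    qed
    also have "\<dots> \<le> (\<Sum>v\<in>F. t * of_bool (v = i0))"
    proof (rule sum_mono)
      fix v assume "v \<in> F"
      then have "c v = 0" using c by auto
      moreover have "edge_degree M v \<le> a v + c v" using M by (simp add: packing_def)
      ultimately show "edge_degree M v \<le> t * of_bool (v = i0)" using \<open>v \<in> F\<close> by (simp add: a_def)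
    qed
    also have "\<dots> = t" using i0 finF by (simp add: of_bool_def if_distrib cong: if_cong)
    finally show ?thesis .
  qed
  moreover have "\<exists>M. packing (\<lambda>v. a v + of_bool (v = i)) M \<and> size M = Suc t" if i: "i \<in> F" for i
  proof -
    obtain w0 where w0: "w0 \<notin> F" "{i0, w0} \<in> E" using nbr i0 by blast
    obtain w where w: "w \<notin> F" "{i, w} \<in> E" using nbr i by blast
    have W: "w0 \<in> V" "w \<in> V" using w0 w V by auto
    have "edge_degree (add_mset {i, w} (replicate_mset t {i0, w0})) v \<le> a v + of_bool (v = i)" for v
      using w0(1) w(1) i i0 W by (auto simp: a_def)
    then show ?thesis using w w0
      by (intro exI[of _ "add_mset {i, w} (replicate_mset t {i0, w0})"]) (auto simp: packing_def)
  qed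
  moreover have "v \<in> V" if "a v \<noteq> 0" for v
    using that i0 V by (auto simp: a_def split: if_splits)
  ultimately have "witness V F a t" unfolding witness_def by blast
  then show ?thesis by (intro exI)
qed

text \<open>Add to a block on U one unit at each vertex outside F. As N[U] lies in F, no edge at U
  can use these units, and the packing number stays that of the block.\<close>

lemma witness_odd_core:
  assumes V: "F \<subseteq> V" "\<Union>E \<subseteq> V" "finite V" and cover: "\<forall>e\<in>E. e \<inter> F \<noteq> {}"
    and core: "odd_core F U" and "U \<noteq> {}"
  shows "\<exists>t0. \<forall>t\<ge>t0. \<exists>a. witness V F a t"
proof -
  have UF: "U \<subseteq> F" and UN: "\<And>u j. u \<in> U \<Longrightarrow> {u, j} \<in> E \<Longrightarrow> j \<in> F" using core by (auto simp: odd_core_def)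
  have "finite U" using UF V finite_subset by metis
  then have "\<exists>s0. \<forall>s\<ge>s0. \<exists>a. block U a s"
    using \<open>U \<noteq> {}\<close> core unfolding odd_core_def by (intro block_odd_core) auto
  moreover have "\<exists>a. witness V F a t" if "block U b t" for b t
  proof -
    have supp: "v \<in> U" if "b v \<noteq> 0" for v using \<open>block U b t\<close> that by (auto simp: block_def)
    define a where "a v = b v + of_bool (v \<in> V - F)" for v
    have "size M \<le> t" if c: "\<forall>i. c i \<noteq> 0 \<longrightarrow> i \<in> V - F" and M: "packing (\<lambda>v. a v + c v) M" for c M
    proof -
      have e: "e \<subseteq> U \<union> (V - F)" if "e \<in># M" for e
        using M _ that by (rule support_edge) (use c supp in \<open>auto simp: a_def\<close>)
      \<comment> \<open>The end in F carries a positive exponent and so lies in U. Its neighbours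
        are in F, hence the other end lies in U too.\<close>
      have eU: "e \<subseteq> U" if "e \<in># M" for e
      proof -
        have "e \<in> E" using M that by (auto simp: packing_def)
        then obtain i where i: "i \<in> e" "i \<in> F" using cover by blast
        with e[OF that] have "i \<in> U" by auto
        obtain j where j: "e = {i, j}" using edge_other[OF \<open>e \<in> E\<close> i(1)] by blast
        then have "j \<in> F" using UN \<open>i \<in> U\<close> \<open>e \<in> E\<close> by blast
        with e[OF that] j \<open>i \<in> U\<close> show ?thesis by auto
      qed
      have "edge_degree M v \<le> b v" for v
      proof (cases "v \<in> U")
        case True
        then have "a v = b v" "c v = 0" using UF c by (auto simp: a_def)
        then show ?thesis using M by (auto simp: packing_def dest: spec[of _ v])
      next
        case False
        then have "edge_degree M v = 0" using eU by (auto simp: edge_degree_eq_0_iff)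
        then show ?thesis by simp
      qed
      then have "packing b M" using M by (simp add: packing_def)
      then show ?thesis using \<open>block U b t\<close> by (simp add: block_def)
    qed
    moreover have "\<exists>M. packing (\<lambda>v. a v + of_bool (v = i)) M \<and> size M = Suc t" if i: "i \<in> F" for i
    proof -
      \<comment> \<open>Raising i admits an edge {i, j} whose other end has a free unit: j is either
        outside F, or in U and missed by a suitable maximum packing of the block.\<close>
      have "\<exists>j M. {i, j} \<in> E \<and> packing b M \<and> size M = t \<and> edge_degree M j < a j"
      proof (cases "\<exists>j. j \<notin> F \<and> {i, j} \<in> E")
        case True
        then obtain j where j: "j \<notin> F" "{i, j} \<in> E" by blast
        obtain M where M: "packing b M" "size M = t" using \<open>block U b t\<close> by (auto simp: block_def)
        have "b j = 0" using supp[of j] j UF by auto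
        then have "edge_degree M j = 0" using M(1) by (metis le_zero_eq packing_def)
        then have "edge_degree M j < a j" using j V by (auto simp: a_def)
        with j M show ?thesis by blast
      next
        case False
        have "\<exists>u\<in>U. {u, i} \<in> E"
        proof (cases "i \<in> U")
          case True
          obtain x k where x: "(i, x) \<in> (edges_on U)\<^sup>*" "odd k" "(x, x) \<in> edges_on U ^^ k"
            using core True by (auto simp: odd_core_def)
          \<comment> \<open>Either a nonempty path leads from i to the odd closed walk, or that walk
            starts at i and has positive length.\<close>
          have "\<exists>u. (i, u) \<in> edges_on U"
          proof (cases "i = x")
            case True
            obtain l where "k = Suc l" using x(2) by (cases k) auto
            with x True show ?thesis using relpow_Suc_D2 by metis
          qed (use x in \<open>metis converse_rtranclE\<close>)
          then show ?thesis by (auto simp: edges_on_def insert_commute)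
        qed (use core i False in \<open>auto simp: odd_core_def\<close>)
        then obtain u where u: "u \<in> U" "{i, u} \<in> E" by (auto simp: insert_commute)
        then obtain M where "packing b M" "size M = t" "edge_degree M u < b u"
          using \<open>block U b t\<close> by (auto simp: block_def)
        then show ?thesis using u by (intro exI[of _ u] exI[of _ M]) (simp add: a_def)
      qed
      then obtain j M where jM: "{i, j} \<in> E" "packing b M" "size M = t" "edge_degree M j < a j" by blast
      have "edge_degree M v \<le> a v" for v using jM(2) by (simp add: packing_def a_def trans_le_add1)
      then have "edge_degree (add_mset {i, j} M) v \<le> a v + of_bool (v = i)" for v
        unfolding edge_degree_simps of_bool_edge[OF jM(1)] using jM(4) by (cases "v = j") auto
      with jM show ?thesis by (intro exI[of _ "add_mset {i, j} M"]) (simp add: packing_def)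
    qed
    moreover have "v \<in> V" if "a v \<noteq> 0" for v
      using that supp[of v] UF V by (auto simp: a_def split: if_splits)
    ultimately have "witness V F a t" unfolding witness_def by blast
    then show ?thesis by (intro exI)
  qed
  ultimately show ?thesis by metis
qed

lemma odd_core_imp_eventually_witness:
  assumes V: "F \<subseteq> V" "\<Union>E \<subseteq> V" "finite V"
    and F: "\<forall>e\<in>E. e \<inter> F \<noteq> {}" "odd_core F U"
  shows "\<exists>t0. \<forall>t\<ge>t0. \<exists>a. witness V F a t"
  using witness_minimal_cover[OF V F(1)] witness_odd_core[OF V F] F(2) by (cases "U = {}") blast+

lemma witness_imp_odd_core:
  assumes V: "\<Union>E \<subseteq> V" and w: "witness V F a t"
  shows "(\<forall>e\<in>E. e \<inter> F \<noteq> {}) \<and> (\<exists>U. odd_core F U)"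
proof (rule odd_core_exists)
  fix c M assume "\<And>i. c i \<noteq> 0 \<Longrightarrow> i \<in> \<Union>E - F" "packing (\<lambda>v. a v + c v) M"
  moreover from this V have "\<forall>i. c i \<noteq> 0 \<longrightarrow> i \<in> V - F" by blast
  ultimately show "size M \<le> t" using w unfolding witness_def by blast
qed (use w in \<open>auto simp: witness_def\<close>)

end

section \<open>Powers of the edge ideal\<close>

locale finite_edge_set = edge_set E for E :: "'v::linorder set set" +
  fixes V :: "'v set"
  assumes finite_V: "finite V" and edges_V: "\<Union>E \<subseteq> V"
begin

text \<open>These turn out to be the exponents of the monomials in I^t, see
  \<open>ideal_power_eq\<close>.\<close>

definition exps :: "nat \<Rightarrow> ('v \<Rightarrow>\<^sub>0 nat) set" where
  "exps t = {m. Poly_Mapping.keys m \<subseteq> V \<and> (\<exists>M. packing (Poly_Mapping.lookup m) M \<and> size M = t)}"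

lemma exponent_filter_exps: "exponent_filter V (exps t)"
  unfolding exponent_filter_def
proof (intro ballI allI impI)
  fix m b :: "'v \<Rightarrow>\<^sub>0 nat"
  assume "m \<in> exps t" and b: "Poly_Mapping.keys b \<subseteq> V"
  then obtain M where "Poly_Mapping.keys m \<subseteq> V" "packing (Poly_Mapping.lookup m) M" "size M = t"
    by (auto simp: exps_def)
  moreover from this have "packing (Poly_Mapping.lookup (b + m)) M"
    by (simp add: packing_def lookup_add trans_le_add2)
  ultimately show "b + m \<in> exps t"
    using b by (auto simp: exps_def keys_exponent_add)
qed

text \<open>Multiplying by I adds one edge to the packing; conversely, any edge of a packing can be
  divided out.\<close>

lemma exps_Suc: "{a + b | a b. a \<in> exps t \<and> b \<in> exps 1} = exps (Suc t)"
proof (intro equalityI subsetI)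
  fix m assume "m \<in> {a + b | a b. a \<in> exps t \<and> b \<in> exps 1}"
  then obtain a b where m: "m = a + b" and ab: "a \<in> exps t" "b \<in> exps 1" by blast
  then obtain M N where "packing (Poly_Mapping.lookup a) M" "size M = t"
    "packing (Poly_Mapping.lookup b) N" "size N = 1" by (auto simp: exps_def)
  then have "packing (Poly_Mapping.lookup m) (M + N) \<and> size (M + N) = Suc t"
    by (auto simp: m packing_def lookup_add intro: add_mono)
  then show "m \<in> exps (Suc t)"
    using ab unfolding exps_def m by (auto simp: keys_exponent_add)
next
  fix m assume "m \<in> exps (Suc t)"
  then obtain M where V: "Poly_Mapping.keys m \<subseteq> V" and M: "packing (Poly_Mapping.lookup m) M" "size M = Suc t"
    by (auto simp: exps_def)
  then obtain e N where N: "M = add_mset e N" "size N = t" by (metis size_eq_Suc_imp_eq_union size_add_mset nat.inject)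
  then have e: "e \<in> E" using M by (auto simp: packing_def)
  then obtain i j where ij: "i \<noteq> j" "e = {i, j}" using edge_pair by blast
  define b :: "'v \<Rightarrow>\<^sub>0 nat" where "b = Poly_Mapping.single i 1 + Poly_Mapping.single j 1"
  have b: "Poly_Mapping.lookup b v = of_bool (v \<in> e)" for v
    using ij by (auto simp: b_def lookup_add lookup_single)
  have le: "of_bool (v \<in> e) + edge_degree N v \<le> Poly_Mapping.lookup m v" for v
    using M(1) by (simp add: packing_def N)
  have "of_bool (v \<in> e) \<le> Poly_Mapping.lookup m v" for v
    using le[of v] by linarith
  then have "m = (m - b) + b"
    by (intro poly_mapping_eqI) (simp add: lookup_add lookup_minus b)
  moreover have "m - b \<in> exps t"
  proof -
    have "edge_degree N v \<le> Poly_Mapping.lookup (m - b) v" for v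
      using le[of v] by (simp add: lookup_minus b)
    then have "packing (Poly_Mapping.lookup (m - b)) N" using M by (simp add: packing_def N)
    moreover have "Poly_Mapping.keys (m - b) \<subseteq> V" using V by (auto simp: in_keys_iff lookup_minus)
    ultimately show ?thesis using N(2) by (auto simp: exps_def)
  qed
  moreover have "b \<in> exps 1"
  proof -
    have "e \<subseteq> V" using e edges_V by blast
    then have "Poly_Mapping.keys b \<subseteq> V" by (auto simp: in_keys_iff b)
    moreover have "packing (Poly_Mapping.lookup b) {#e#}" using e by (simp add: packing_def b)
    ultimately show ?thesis unfolding exps_def by (auto intro!: exI[of _ "{#e#}"])
  qed
  ultimately show "m \<in> {a + b | a b. a \<in> exps t \<and> b \<in> exps 1}" by blast
qed

lemma exps_1:
  "{b + g | b g. g \<in> {Poly_Mapping.single i 1 + Poly_Mapping.single j 1 | i j. {i, j} \<in> E} \<and> Poly_Mapping.keys b \<subseteq> V} = exps 1"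
  (is "?L = _")
proof (intro equalityI subsetI)
  fix m assume "m \<in> ?L"
  then obtain b i j where m: "m = b + (Poly_Mapping.single i 1 + Poly_Mapping.single j 1)" "{i, j} \<in> E"
    "Poly_Mapping.keys b \<subseteq> V" by blast
  then have "packing (Poly_Mapping.lookup m) {#{i, j}#}"
    using edge_neq[OF m(2)] by (auto simp: packing_def lookup_add lookup_single)
  moreover have "Poly_Mapping.keys m \<subseteq> V"
    using m edges_V by (auto simp: keys_exponent_add)
  ultimately show "m \<in> exps 1" unfolding exps_def by (auto intro!: exI[of _ "{#{i, j}#}"])
next
  fix m assume "m \<in> exps 1"
  then obtain M where V: "Poly_Mapping.keys m \<subseteq> V" and M: "packing (Poly_Mapping.lookup m) M" "size M = 1"
    by (auto simp: exps_def)
  then obtain e where N: "M = {#e#}" by (metis size_1_singleton_mset)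
  then have e: "e \<in> E" using M by (auto simp: packing_def)
  then obtain i j where ij: "i \<noteq> j" "e = {i, j}" using edge_pair by blast
  define g :: "'v \<Rightarrow>\<^sub>0 nat" where "g = Poly_Mapping.single i 1 + Poly_Mapping.single j 1"
  have g: "Poly_Mapping.lookup g v = of_bool (v \<in> e)" for v
    using ij by (auto simp: g_def lookup_add lookup_single)
  have le: "of_bool (v \<in> e) \<le> Poly_Mapping.lookup m v" for v
    using M(1) by (simp add: packing_def N)
  have "m = (m - g) + g"
    using le by (intro poly_mapping_eqI) (simp add: lookup_add lookup_minus g)
  moreover have "Poly_Mapping.keys (m - g) \<subseteq> V" using V by (auto simp: in_keys_iff lookup_minus)
  ultimately show "m \<in> ?L" using e ij unfolding g_def by blast
qed

definition edge_set_ideal :: "('v, 'k::field) mpolynomial set" where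
  "edge_set_ideal = Idl\<^bsub>mpoly_ring V\<^esub> {mvar i * mvar j | i j. {i, j} \<in> E}"

lemma edge_set_ideal_eq: "(edge_set_ideal :: ('v, 'k::field) mpolynomial set) = monomial_ideal V (exps 1)"
proof -
  let ?G = "{Poly_Mapping.single i (1::nat) + Poly_Mapping.single j 1 | i j. {i, j} \<in> E}"
  have "{mvar i * mvar j | i j. {i, j} \<in> E} = (\<lambda>g. Poly_Mapping.single g (1::'k)) ` ?G"
    by (auto simp: mvar_def mult_single)
  moreover have G: "Poly_Mapping.keys g \<subseteq> V" if "g \<in> ?G" for g
  proof -
    from that obtain i j where "g = Poly_Mapping.single i 1 + Poly_Mapping.single j 1" "{i, j} \<in> E" by blast
    moreover from this have "i \<in> V" "j \<in> V" using edges_V by auto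
    ultimately show ?thesis by (auto simp: keys_exponent_add)
  qed
  ultimately show ?thesis
    unfolding edge_set_ideal_def exps_1[symmetric] by (simp only: monomial_ideal_eq_genideal[OF G])
qed

lemma ideal_power_eq:
  "ideal_power (mpoly_ring V) (edge_set_ideal :: ('v, 'k::field) mpolynomial set) t = monomial_ideal V (exps t)"
proof (induction t)
  case 0
  \<comment> \<open>I^0 is the whole ring: the empty packing fits under every exponent.\<close>
  have "m \<in> exps 0" if "Poly_Mapping.keys m \<subseteq> V" for m
    using that by (auto simp: exps_def packing_def)
  then show ?case
    by (auto simp: ideal_power_def ideals_set_def monomial_ideal_def nat_pow_def)
next
  case (Suc t)
  have "ideal_power (mpoly_ring V) edge_set_ideal (Suc t)
      = ideal_prod (mpoly_ring V) (ideal_power (mpoly_ring V) edge_set_ideal t) (edge_set_ideal :: ('v, 'k) mpolynomial set)"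
    by (simp add: ideal_power_def ideals_set_def nat_pow_def)
  also have "\<dots> = monomial_ideal V (exps (Suc t))"
    unfolding Suc.IH unfolding edge_set_ideal_eq exps_Suc[symmetric]
    by (intro monomial_ideal_prod exponent_filter_exps) (auto simp: exps_def)
  finally show ?case .
qed

lemma packing_subset:
  assumes "packing a M" "n \<le> size M"
  shows "\<exists>N. packing a N \<and> size N = n"
  using assms
proof (induction M)
  case (add e M)
  show ?case
  proof (cases "n = Suc (size M)")
    case True
    with add.prems show ?thesis by (intro exI[of _ "add_mset e M"]) simp
  next
    case False
    moreover have "packing a M" using add.prems(1) by (auto simp: packing_def dest: add_leD2)
    ultimately show ?thesis using add by simp
  qed
qed auto

text \<open>Monomials outside P_F are supported outside F and become the vectors c of a witness;
  those in P_F are multiples of some x_i with i in F. The index is \<open>Suc t\<close> because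
  packings bounded by t mean that a monomial is not in I^(t+1).\<close>

lemma associated_prime_iff:
  fixes P :: "('v, 'k::field) mpolynomial set"
  shows "P \<in> associated_primes (mpoly_ring V) (ideal_power (mpoly_ring V) edge_set_ideal (Suc t))
    \<longleftrightarrow> (\<exists>F\<subseteq>V. P = variable_ideal V F \<and> (\<exists>a. witness V F a t))" (is "?L \<longleftrightarrow> ?R")
proof
  assume ?L
  then obtain F m where F: "F \<subseteq> V" "P = variable_ideal V F" and mV: "Poly_Mapping.keys m \<subseteq> V"
    and m: "\<And>b. Poly_Mapping.keys b \<subseteq> V \<Longrightarrow> b + m \<in> exps (Suc t) \<longleftrightarrow> Poly_Mapping.keys b \<inter> F \<noteq> {}"
    unfolding ideal_power_eq by (rule associated_primeE[OF exponent_filter_exps]) (rule that)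
  have "witness V F (Poly_Mapping.lookup m) t"
    unfolding witness_def
  proof (intro conjI allI impI ballI)
    fix v assume "Poly_Mapping.lookup m v \<noteq> 0"
    then show "v \<in> V" using mV by (auto simp: in_keys_iff)
  next
    fix c M assume c: "\<forall>i. c i \<noteq> 0 \<longrightarrow> i \<in> V - F" and M: "packing (\<lambda>v. Poly_Mapping.lookup m v + c v) M"
    have "{i. c i \<noteq> 0} \<subseteq> V" using c by auto
    then have "finite {i. c i \<noteq> 0}" using finite_V finite_subset by blast
    then have lookup: "Poly_Mapping.lookup (Abs_poly_mapping c) = c" by simp
    let ?b = "Abs_poly_mapping c"
    have b: "Poly_Mapping.keys ?b \<subseteq> V - F" using c by (auto simp: in_keys_iff lookup)
    then have nin: "?b + m \<notin> exps (Suc t)" using m[of ?b] by blast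
    show "size M \<le> t"
    proof (rule ccontr)
      assume "\<not> size M \<le> t"
      then obtain N where "packing (\<lambda>v. Poly_Mapping.lookup m v + c v) N" "size N = Suc t"
        using packing_subset[OF M, of "Suc t"] by auto
      moreover have "(\<lambda>v. Poly_Mapping.lookup m v + c v) = Poly_Mapping.lookup (?b + m)"
        by (simp add: fun_eq_iff lookup_add lookup add.commute)
      moreover have "Poly_Mapping.keys (?b + m) \<subseteq> V" using b mV by (auto simp: keys_exponent_add)
      ultimately show False using nin unfolding exps_def by auto
    qed
  next
    fix i assume i: "i \<in> F"
    then have "Poly_Mapping.single i 1 + m \<in> exps (Suc t)"
      using m[of "Poly_Mapping.single i 1"] F(1) by auto
    moreover have "Poly_Mapping.lookup (Poly_Mapping.single i 1 + m) = (\<lambda>v. Poly_Mapping.lookup m v + of_bool (v = i))"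
      by (auto simp: fun_eq_iff lookup_add lookup_single)
    ultimately show "\<exists>M. packing (\<lambda>v. Poly_Mapping.lookup m v + of_bool (v = i)) M \<and> size M = Suc t"
      unfolding exps_def by simp
  qed
  with F show ?R by blast
next
  assume ?R
  then obtain F a where F: "F \<subseteq> V" "P = variable_ideal V F" and a: "witness V F a t" by blast
  have supp: "\<And>v. a v \<noteq> 0 \<Longrightarrow> v \<in> V"
    and upper: "\<And>c M. (\<forall>i. c i \<noteq> 0 \<longrightarrow> i \<in> V - F) \<Longrightarrow> packing (\<lambda>v. a v + c v) M \<Longrightarrow> size M \<le> t"
    and lower: "\<And>i. i \<in> F \<Longrightarrow> \<exists>M. packing (\<lambda>v. a v + of_bool (v = i)) M \<and> size M = Suc t"
    using a unfolding witness_def by blast+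
  have "{v. a v \<noteq> 0} \<subseteq> V" using supp by auto
  then have "finite {v. a v \<noteq> 0}" using finite_V finite_subset by blast
  then have lookup: "Poly_Mapping.lookup (Abs_poly_mapping a) = a" by simp
  let ?m = "Abs_poly_mapping a"
  have mV: "Poly_Mapping.keys ?m \<subseteq> V" using supp by (auto simp: in_keys_iff lookup)
  have "b + ?m \<in> exps (Suc t) \<longleftrightarrow> Poly_Mapping.keys b \<inter> F \<noteq> {}" if b: "Poly_Mapping.keys b \<subseteq> V" for b
  proof
    assume "b + ?m \<in> exps (Suc t)"
    then obtain M where "packing (Poly_Mapping.lookup (b + ?m)) M" "size M = Suc t"
      by (auto simp: exps_def)
    moreover have "Poly_Mapping.lookup (b + ?m) = (\<lambda>v. a v + Poly_Mapping.lookup b v)"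
      by (simp add: fun_eq_iff lookup_add lookup)
    ultimately have "\<not> (\<forall>i. Poly_Mapping.lookup b i \<noteq> 0 \<longrightarrow> i \<in> V - F)"
      using upper[of "Poly_Mapping.lookup b" M] by auto
    then obtain i where "i \<in> Poly_Mapping.keys b" "i \<notin> V - F" by (auto simp: in_keys_iff)
    then show "Poly_Mapping.keys b \<inter> F \<noteq> {}" using b by blast
  next
    assume "Poly_Mapping.keys b \<inter> F \<noteq> {}"
    then obtain i where i: "i \<in> Poly_Mapping.keys b" "i \<in> F" by blast
    then obtain M where M: "packing (\<lambda>v. a v + of_bool (v = i)) M" "size M = Suc t" using lower by blast
    have "a v + of_bool (v = i) \<le> Poly_Mapping.lookup (b + ?m) v" for v
      using i(1) by (auto simp: lookup_add lookup in_keys_iff)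
    with M(1) have "packing (Poly_Mapping.lookup (b + ?m)) M"
      unfolding packing_def by (meson order_trans)
    with M(2) b mV show "b + ?m \<in> exps (Suc t)" unfolding exps_def by (auto simp: keys_exponent_add)
  qed
  then have "variable_ideal V F \<in> associated_primes (mpoly_ring V) (monomial_ideal V (exps (Suc t)))"
    by (intro variable_ideal_associated_prime[OF F(1) exponent_filter_exps mV])
  then show ?L by (simp add: F(2) ideal_power_eq)
qed

text \<open>Each F satisfying the condition has witnesses from some index on, and as there are
  finitely many F, one index serves all. Conversely any witness yields the condition, so Ass(I^t) is
  determined for all large t.\<close>

lemma stable_associated_primes_eq:
  "stable_associated_primes (mpoly_ring V) (edge_set_ideal :: ('v, 'k::field) mpolynomial set)
    = variable_ideal V ` {F. F \<subseteq> V \<and> (\<forall>e\<in>E. e \<inter> F \<noteq> {}) \<and> (\<exists>U. odd_core F U)}"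
proof -
  define S where "S = {F. F \<subseteq> V \<and> (\<forall>e\<in>E. e \<inter> F \<noteq> {}) \<and> (\<exists>U. odd_core F U)}"
  define Ass where "Ass t = associated_primes (mpoly_ring V)
    (ideal_power (mpoly_ring V) (edge_set_ideal :: ('v, 'k) mpolynomial set) t)" for t
  have "\<forall>F\<in>S. \<forall>\<^sub>F t in sequentially. \<exists>a. witness V F a t"
    using odd_core_imp_eventually_witness[OF _ edges_V finite_V]
    unfolding S_def eventually_sequentially by blast
  moreover have "finite S"
    by (rule finite_subset[of _ "Pow V"]) (use finite_V in \<open>auto simp: S_def\<close>)
  ultimately have "\<forall>\<^sub>F t in sequentially. \<forall>F\<in>S. \<exists>a. witness V F a t"
    by (rule eventually_ball_finite[rotated])
  then obtain t0 where t0: "\<forall>t\<ge>t0. \<forall>F\<in>S. \<exists>a. witness V F a t"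
    unfolding eventually_sequentially by (elim exE)
  have "Ass (Suc t) = variable_ideal V ` S" if "t \<ge> t0" for t
  proof -
    have S_iff: "F \<in> S \<longleftrightarrow> F \<subseteq> V \<and> (\<exists>a. witness V F a t)" for F
    proof
      assume "F \<in> S"
      then show "F \<subseteq> V \<and> (\<exists>a. witness V F a t)" using t0 that by (simp add: S_def)
    next
      assume "F \<subseteq> V \<and> (\<exists>a. witness V F a t)"
      then show "F \<in> S"
        using witness_imp_odd_core[OF edges_V] unfolding S_def by (elim conjE exE) simp
    qed
    have "P \<in> Ass (Suc t) \<longleftrightarrow> P \<in> variable_ideal V ` S" for P
      unfolding Ass_def associated_prime_iff image_iff Bex_def S_iff by blast
    then show ?thesis by blast
  qed
  then have stable: "Ass t = variable_ideal V ` S" if "t \<ge> Suc t0" for t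
    using that by (metis Suc_le_D Suc_le_mono)
  let ?Q = "\<lambda>t0. \<forall>t\<ge>t0. Ass t = Ass (Suc t)"
  define L where "L = (LEAST t0. ?Q t0)"
  have "?Q (Suc t0)" using stable by simp
  then have L: "?Q L" unfolding L_def by (rule LeastI)
  \<comment> \<open>The least index of constancy may be smaller than t0 + 1; constancy from there on
    carries the value back from larger indices.\<close>
  have "Ass (L + d) = Ass L" for d
  proof (induction d)
    case (Suc d)
    have "Ass (L + d) = Ass (Suc (L + d))" using L by (meson le_add1)
    with Suc.IH show ?case by (simp only: add_Suc_right)
  qed simp
  from this[of "Suc t0"] have "Ass L = variable_ideal V ` S" using stable[of "L + Suc t0"] by (simp only: le_add2)
  then show ?thesis by (simp add: stable_associated_primes_def Ass_def L_def S_def)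
qed

lemma variable_ideal_stable_iff:
  assumes "F \<subseteq> V"
  shows "(variable_ideal V F :: ('v, 'k::field) mpolynomial set)
      \<in> stable_associated_primes (mpoly_ring V) edge_set_ideal
    \<longleftrightarrow> (\<forall>e\<in>E. e \<inter> F \<noteq> {}) \<and> (\<exists>U. odd_core F U)"
proof -
  have "inj_on (variable_ideal V :: _ \<Rightarrow> ('v, 'k) mpolynomial set) (Pow V)"
    by (rule inj_onI) (auto dest: variable_ideal_inj[rotated 2])
  then show ?thesis
    unfolding stable_associated_primes_eq using assms
    by (subst inj_on_image_mem_iff[where B = "Pow V"]) auto
qed

end

section \<open>Connected components and odd cycles\<close>

text \<open>A repeated vertex splits an odd closed walk into two shorter closed walks, one of which
  is odd.\<close>

lemma (in wf_digraph) odd_closed_awalk_imp_cycle: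
  assumes "awalk u p u" "odd (length p)"
  shows "\<exists>q. cycle q \<and> odd (length q)"
  using assms
proof (induction "length p" arbitrary: u p rule: less_induct)
  case less
  then obtain e p' where p: "p = e # p'" by (cases p) auto
  show ?case
  proof (cases "distinct (tl (awalk_verts u p))")
    case True
    moreover have "p \<noteq> []" by (simp add: p)
    ultimately show ?thesis using less.prems unfolding cycle_def by blast
  next
    case False
    have p': "awalk (head G e) p' u" "tail G e = u" "e \<in> arcs G"
      using less.prems(1) by (auto simp: p awalk_Cons_iff)
    \<comment> \<open>\<open>cycle\<close> requires distinctness without the initial vertex, that
      is, along the walk behind the first arc \<open>e\<close>.\<close>
    have "\<not> distinct (awalk_verts (head G e) p')"
      using False by (simp add: p)
    from awalk_not_distinct_decomp[OF p'(1) this] obtain q r s w where w: "p' = q @ r @ s" "0 < length r"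
      "awalk (head G e) q w" "awalk w r w" "awalk w s u"
      by (elim exE conjE)
    show ?thesis
    proof (cases "odd (length r)")
      case True
      with w p show ?thesis using less.hyps[of r w] by simp
    next
      case False
      have "awalk u (e # q @ s) u"
        using p' w by (auto simp: awalk_Cons_iff)
      with False w p less.prems(2) show ?thesis using less.hyps[of "e # q @ s" u] by simp
    qed
  qed
qed

lemma (in wf_digraph) awalk_imp_relpow: "awalk u p v \<Longrightarrow> (u, v) \<in> arcs_ends G ^^ length p"
proof (induction p arbitrary: u)
  case (Cons e p)
  then have "(u, head G e) \<in> arcs_ends G" "(head G e, v) \<in> arcs_ends G ^^ length p"
    by (auto simp: awalk_Cons_iff arcs_ends_conv)
  then show ?case by (simp add: relpow_Suc_I2 del: relpow.simps)
qed (simp add: awalk_Nil_iff)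

lemma (in wf_digraph) relpow_imp_awalk:
  "(u, v) \<in> arcs_ends G ^^ k \<Longrightarrow> v \<in> verts G \<Longrightarrow> \<exists>p. awalk u p v \<and> length p = k"
proof (induction k arbitrary: u)
  case 0
  then show ?case by (auto simp: awalk_Nil_iff)
next
  case (Suc k)
  obtain w where "(u, w) \<in> arcs_ends G" "(w, v) \<in> arcs_ends G ^^ k"
    using relpow_Suc_D2[OF Suc.prems(1)] by blast
  moreover then obtain p where "awalk w p v" "length p = k" using Suc by blast
  moreover obtain e where "e \<in> arcs G" "tail G e = u" "head G e = w"
    using calculation(1) by (auto simp: arcs_ends_conv)
  ultimately show ?case by (intro exI[of _ "e # p"]) (auto simp: awalk_Cons_iff)
qed

lemma strongly_connected_imp_connected:
  assumes "wf_digraph H" "symmetric H" "strongly_connected H"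
  shows "connected H"
  using assms(3) wf_digraph.reachable_mk_symmetric_eq[OF assms(1,2)]
  unfolding connected_def strongly_connected_def by (simp add: mk_symmetric_def)

context sym_digraph begin

text \<open>\<open>connected\<close> means strong connectedness of the symmetric closure, and the
  closure adds no reachability to the symmetric G.\<close>

lemma connected_subgraph_reachable:
  assumes "subgraph H G" "connected H" "u \<in> verts H" "v \<in> verts H"
  shows "u \<rightarrow>\<^sup>* v"
proof -
  have "u \<rightarrow>\<^sup>*\<^bsub>mk_symmetric H\<^esub> v"
    using assms unfolding connected_def strongly_connected_def by (simp add: mk_symmetric_def)
  moreover have "subgraph (mk_symmetric H) (mk_symmetric G)"
    using assms(1) by (rule subgraph_mk_symmetric)
  ultimately have "u \<rightarrow>\<^sup>*\<^bsub>mk_symmetric G\<^esub> v" by (metis pre_digraph.reachable_mono)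
  then show ?thesis by (simp add: reachable_mk_symmetric_eq[OF sym_arcs])
qed

text \<open>The maximal connected subgraph is not assumed to be induced. But all connected subgraphs
  through u lie in the graph induced on the reachability class of u, which is connected
  itself.\<close>

lemma connected_component_iff:
  "connected_component G C \<longleftrightarrow> (\<exists>u\<in>verts G. C = G \<restriction> {v. u \<rightarrow>\<^sup>* v})" (is "_ \<longleftrightarrow> (\<exists>u\<in>_. C = ?K u)")
proof -
  have K: "subgraph (?K u) G" "connected (?K u)" if "u \<in> verts G" for u
  proof -
    have "?K u \<in> sccs" using that by (rule induce_reachable_is_in_sccs)
    then have ind: "induced_subgraph (?K u) G" and "strongly_connected (?K u)" by (auto simp: sccs_def)
    moreover have "symmetric (?K u)" using sym_arcs ind by (rule induced_graph_imp_symmetric)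
    moreover have "wf_digraph (?K u)" using ind by auto
    ultimately show "connected (?K u)" by (intro strongly_connected_imp_connected)
    show "subgraph (?K u) G" using ind by (rule induced_imp_subgraph)
  qed
  have sub: "subgraph H (?K u)" if H: "subgraph H G" "connected H" "u \<in> verts H" for H u
  proof -
    have "verts H \<subseteq> {v. u \<rightarrow>\<^sup>* v}" using connected_subgraph_reachable[OF H] by blast
    moreover have "wf_digraph H" "tail G = tail H" "head G = head H"
      using H(1) by (auto simp: subgraph_def compatible_def)
    ultimately show ?thesis
      using H(1) wellformed_induce_subgraph[of "{v. u \<rightarrow>\<^sup>* v}"] wf_digraph.wellformed[of H]
      unfolding subgraph_def compatible_def by auto
  qed
  show ?thesis
  proof
    assume "connected_component G C"
    then have C: "subgraph C G" "connected C" and max: "\<And>H. H \<noteq> C \<Longrightarrow> subgraph C H \<Longrightarrow> subgraph H G \<Longrightarrow> \<not> connected H"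
      by (auto simp: connected_component_def max_subgraph_def)
    then obtain u where u: "u \<in> verts C"
      unfolding connected_def strongly_connected_def by (auto simp: mk_symmetric_def)
    with C(1) have "u \<in> verts G" by auto
    with K[OF this] sub[OF C u] max[of "?K u"] show "\<exists>u\<in>verts G. C = ?K u" by blast
  next
    assume "\<exists>u\<in>verts G. C = ?K u"
    then obtain u where u: "u \<in> verts G" "C = ?K u" by blast
    have "H = ?K u" if "subgraph (?K u) H" "subgraph H G" "connected H" for H
    proof -
      have "u \<in> verts (?K u)" using u(1) by simp
      then have "u \<in> verts H" using subgraph_imp_subverts[OF that(1)] by blast
      then have "subgraph H (?K u)" using sub that by blast
      with that(1) show ?thesis
        by (intro pre_digraph.equality) (auto simp: subgraph_def compatible_def)
    qed
    with K[OF u(1)] show "connected_component G C"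
      unfolding connected_component_def max_subgraph_def u(2) by blast
  qed
qed

text \<open>A walk starting in the reachability class never leaves it, so an odd closed walk there
  shortens to an odd cycle of the component.\<close>

lemma has_odd_cycle_component_iff:
  assumes u: "u \<in> verts G"
  shows "has_odd_cycle (G \<restriction> {v. u \<rightarrow>\<^sup>* v})
    \<longleftrightarrow> (\<exists>x k. (u, x) \<in> (arcs_ends G)\<^sup>* \<and> odd k \<and> (x, x) \<in> arcs_ends G ^^ k)"
proof -
  let ?K = "G \<restriction> {v. u \<rightarrow>\<^sup>* v}"
  interpret K: wf_digraph ?K by (rule wellformed_induce_subgraph)
  have sub: "arcs_ends ?K \<subseteq> arcs_ends G" by (auto simp: arcs_ends_conv)
  have pow: "arcs_ends ?K ^^ k \<subseteq> arcs_ends G ^^ k" for k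
    by (induction k) (use sub in \<open>auto intro: relcomp_mono\<close>)
  have restr: "(x, y) \<in> arcs_ends ?K ^^ k" if "(x, y) \<in> arcs_ends G ^^ k" "x \<in> verts ?K" for x y k
    using that
  proof (induction k arbitrary: x)
    case (Suc k)
    obtain z where z: "(x, z) \<in> arcs_ends G" "(z, y) \<in> arcs_ends G ^^ k"
      using relpow_Suc_D2[OF Suc.prems(1)] by blast
    have x: "u \<rightarrow>\<^sup>* x" using Suc.prems(2) by simp
    then have uz: "u \<rightarrow>\<^sup>* z" using z(1) by (rule reachable_adj_trans)
    then have "(x, z) \<in> arcs_ends ?K"
      using z(1) x by (auto simp: arcs_ends_conv)
    moreover have "(z, y) \<in> arcs_ends ?K ^^ k" using Suc.IH z(2) uz by simp
    ultimately show ?case by (simp add: relpow_Suc_I2 del: relpow.simps)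
  qed simp
  show ?thesis
  proof
    assume "has_odd_cycle ?K"
    then obtain x p where xp: "K.awalk x p x" "odd (length p)" by (auto simp: has_odd_cycle_def K.cycle_def)
    then have "(x, x) \<in> arcs_ends G ^^ length p" using K.awalk_imp_relpow pow by blast
    moreover have "x \<in> verts ?K" using xp(1) by (rule K.awalk_hd_in_verts)
    then have "(u, x) \<in> (arcs_ends G)\<^sup>*" using reachable_conv'[OF u] by simp
    ultimately show "\<exists>x k. (u, x) \<in> (arcs_ends G)\<^sup>* \<and> odd k \<and> (x, x) \<in> arcs_ends G ^^ k"
      using xp(2) by blast
  next
    assume "\<exists>x k. (u, x) \<in> (arcs_ends G)\<^sup>* \<and> odd k \<and> (x, x) \<in> arcs_ends G ^^ k"
    then obtain x k where xk: "(u, x) \<in> (arcs_ends G)\<^sup>*" "odd k" "(x, x) \<in> arcs_ends G ^^ k" by blast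
    then have "x \<in> verts ?K" using reachable_conv'[OF u] by simp
    then obtain p where "K.awalk x p x" "length p = k"
      using K.relpow_imp_awalk[OF restr[OF xk(3)]] by blast
    then show "has_odd_cycle ?K"
      using K.odd_closed_awalk_imp_cycle xk(2) unfolding has_odd_cycle_def by blast
  qed
qed

end

section \<open>Minimal covers above a set, and the final equivalence\<close>

lemma minimal_cover_containing_iff:
  assumes "pair_graph \<Gamma>" "cover \<Gamma> F"
  shows "minimal_cover_containing \<Gamma> N F
    \<longleftrightarrow> N \<subseteq> F \<and> (\<forall>i\<in>F. i \<in> N \<or> (\<exists>j. j \<notin> F \<and> (i, j) \<in> parcs \<Gamma>))"
proof -
  interpret pair_graph \<Gamma> by fact
  show ?thesis
  proof
    assume min: "minimal_cover_containing \<Gamma> N F"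
    have "\<exists>j. j \<notin> F \<and> (i, j) \<in> parcs \<Gamma>" if i: "i \<in> F" "i \<notin> N" for i
    proof -
      \<comment> \<open>Removing i alone must uncover an edge at i; as there are no loops, its other
        end lies outside F.\<close>
      have "F - {i} \<subset> F" "N \<subseteq> F - {i}" using min i by (auto simp: minimal_cover_containing_def)
      then have "\<not> cover \<Gamma> (F - {i})" using min unfolding minimal_cover_containing_def by blast
      then obtain a b where ab: "(a, b) \<in> parcs \<Gamma>" "a \<notin> F - {i}" "b \<notin> F - {i}"
        using assms(2) by (auto simp: cover_def)
      have "a \<in> F \<or> b \<in> F" using assms(2) ab(1) by (auto simp: cover_def)
      moreover have "a \<noteq> b" using ab(1) no_loops' by blast
      ultimately show ?thesis using ab arcs_symmetric by blast
    qed
    then show "N \<subseteq> F \<and> (\<forall>i\<in>F. i \<in> N \<or> (\<exists>j. j \<notin> F \<and> (i, j) \<in> parcs \<Gamma>))"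
      using min by (auto simp: minimal_cover_containing_def)
  next
    assume R: "N \<subseteq> F \<and> (\<forall>i\<in>F. i \<in> N \<or> (\<exists>j. j \<notin> F \<and> (i, j) \<in> parcs \<Gamma>))"
    have False if F': "F' \<subset> F" "cover \<Gamma> F'" "N \<subseteq> F'" for F'
    proof -
      obtain i where i: "i \<in> F" "i \<notin> F'" using F'(1) by blast
      with R F' obtain j where "j \<notin> F" "(i, j) \<in> parcs \<Gamma>" by blast
      with i F' show False by (auto simp: cover_def)
    qed
    with R assms(2) show "minimal_cover_containing \<Gamma> N F"
      unfolding minimal_cover_containing_def by blast
  qed
qed

lemma minimal_cover_iff_containing_empty: "minimal_cover \<Gamma> F \<longleftrightarrow> minimal_cover_containing \<Gamma> {} F"
  by (simp add: minimal_cover_def minimal_cover_containing_def)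

theorem corollary3p6:
  fixes n :: nat and \<Gamma> :: "nat pair_pre_digraph" and F :: "nat set"
  assumes "n \<ge> 1"
    and "pair_graph \<Gamma>" and "pverts \<Gamma> = {1..n}"
    and "cover \<Gamma> F"
  shows "(variable_ideal {1..n} F :: (nat, 'k::field) mpolynomial set)
           \<in> stable_associated_primes (mpoly_ring {1..n}) (edge_ideal \<Gamma>)
         \<longleftrightarrow> minimal_cover \<Gamma> F \<or>
             (\<exists>U \<subseteq> {1..n}.
                (\<forall>C. connected_component (with_proj \<Gamma> \<restriction> U) C \<longrightarrow> has_odd_cycle C) \<and>
                minimal_cover_containing \<Gamma> (closed_neighborhood \<Gamma> U) F)"
proof -
  interpret \<Gamma>: pair_graph \<Gamma> by fact
  define E where "E = {{i, j} | i j. (i, j) \<in> parcs \<Gamma>}"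
  have E: "{i, j} \<in> E \<longleftrightarrow> (i, j) \<in> parcs \<Gamma>" for i j
    using \<Gamma>.arcs_symmetric by (auto simp: E_def doubleton_eq_iff)
  interpret finite_edge_set E "{1..n}"
  proof
    show "\<exists>i j. i \<noteq> j \<and> e = {i, j}" if "e \<in> E" for e
      using that \<Gamma>.no_loops' unfolding E_def by blast
    show "\<Union>E \<subseteq> {1..n}"
      using \<Gamma>.wellformed' unfolding E_def assms(3)[symmetric] by blast
  qed simp
  have FV: "F \<subseteq> {1..n}" using assms(3,4) by (simp add: cover_def)
  have cover: "\<forall>e\<in>E. e \<inter> F \<noteq> {}" using assms(4) by (auto simp: E_def cover_def)
  have "(edge_ideal \<Gamma> :: (nat, 'k) mpolynomial set) = edge_set_ideal"
    unfolding edge_ideal_def edge_set_ideal_def E assms(3) by (rule refl)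
  then have iff: "(variable_ideal {1..n} F :: (nat, 'k) mpolynomial set)
           \<in> stable_associated_primes (mpoly_ring {1..n}) (edge_ideal \<Gamma>) \<longleftrightarrow> (\<exists>U. odd_core F U)"
    using variable_ideal_stable_iff[OF FV] cover by simp
  \<comment> \<open>Every vertex of U lies in the component reachable from it, so the condition on
    components becomes one on vertices.\<close>
  have odd: "(\<forall>C. connected_component (with_proj \<Gamma> \<restriction> U) C \<longrightarrow> has_odd_cycle C)
      \<longleftrightarrow> (\<forall>u\<in>U. \<exists>x k. (u, x) \<in> (edges_on U)\<^sup>* \<and> odd k \<and> (x, x) \<in> edges_on U ^^ k)"
    if "U \<subseteq> {1..n}" for U
  proof -
    let ?H = "with_proj \<Gamma> \<restriction> U"
    have ends: "arcs_ends ?H = edges_on U" by (auto simp: edges_on_def E arcs_ends_conv)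
    have "induced_subgraph ?H (with_proj \<Gamma>)" using that assms(3) by (intro \<Gamma>.induced_induce) simp
    then have "symmetric ?H" by (rule induced_graph_imp_symmetric[OF \<Gamma>.sym_arcs])
    then interpret H: sym_digraph ?H
      using \<Gamma>.wellformed_induce_subgraph by (simp add: sym_digraph_def sym_digraph_axioms_def)
    show ?thesis
      unfolding H.connected_component_iff using H.has_odd_cycle_component_iff unfolding ends
      by (auto simp del: relpow.simps)
  qed
  have core: "odd_core F U \<longleftrightarrow> (\<forall>C. connected_component (with_proj \<Gamma> \<restriction> U) C \<longrightarrow> has_odd_cycle C) \<and>
                minimal_cover_containing \<Gamma> (closed_neighborhood \<Gamma> U) F" if "U \<subseteq> {1..n}" for U
    unfolding odd[OF that] odd_core_def minimal_cover_containing_iff[OF assms(2,4)] closed_neighborhood_def E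
    by blast
  \<comment> \<open>As N[{}] is empty, the core U = {} accounts for the alternative that F is a
    minimal cover.\<close>
  have empty: "odd_core F {} \<longleftrightarrow> minimal_cover \<Gamma> F"
    unfolding odd_core_def minimal_cover_iff_containing_empty minimal_cover_containing_iff[OF assms(2,4)] E
    by blast
  have "U \<subseteq> {1..n}" if "odd_core F U" for U
    using that FV by (auto simp: odd_core_def)
  then have "(\<exists>U. odd_core F U) \<longleftrightarrow> odd_core F {} \<or> (\<exists>U\<subseteq>{1..n}. odd_core F U)" by blast
  then show ?thesis unfolding iff empty by (simp only: core cong: conj_cong)
qed

end
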